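(* Let $t=(\mathcal{G},\sigma,\Omega)$ be a symplectic symmetric triple. Let $$t=\bigoplus_{\alpha=0}^{p}t_\alpha=\bigoplus_{\beta=0}^{q}t'_\beta$$ be two decompositions of $t$ as direct sums of symplectic symmetric triples such that $t_0$ and $t'_0$ are flat and, for all $\alpha,\beta\geq1$, $t_\alpha$ and $t'_\beta$ are indecomposable and non-flat. Then: (i) $p=q$; (ii) there exist a permutation $\eta$ of $\{1,\dots,p\}$ and an automorphism $\varphi$ of $t$ such that $\varphi t_0=t'_0$ and $\varphi t_\alpha=t'_{\eta(\alpha)}$ for all $\alpha\in\{1,\dots,p\}$.
   Context: A symplectic symmetric triple is a triple $t=(\mathcal{G},\sigma,\Omega)$ where: (i) $\mathcal{G}$ is a finite-dimensional real Lie algebra; (ii) $\sigma$ is an involutive automorphism of $\mathcal{G}$ such that, writing $\mathcal{G}=\mathcal{K}\oplus\mathcal{P}$ with $\sigma=\mathrm{id}_{\mathcal{K}}\oplus(-\mathrm{id}_{\mathcal{P}})$, one has $[\mathcal{P},\mathcal{P}]=\mathcal{K}$ and $\mathcal{K}$ acts faithfully on $\mathcal{P}$; (iii) $\Omega$ is a $\mathcal{K}$-invariant symplectic form on $\mathcal{P}$. It is flat if $\mathcal{K}=\{0\}$ (the zero triple is flat). An automorphism of $t$ is a Lie algebra automorphism of $\mathcal{G}$ commuting with $\sigma$ and whose restriction to $\mathcal{P}$ preserves $\Omega$. Direct sums are defined in the obvious way (direct sum of $\sigma$-stable ideals with restricted involutions, the subspaces $\mathcal{P}_\alpha$ being mutually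 $\Omega$-orthogonal and carrying the restricted forms). A triple is decomposable if it is a direct sum of two non-trivial triples, indecomposable otherwise. *)

theory Defs
  imports "HOL-Analysis.Analysis" "HOL-Combinatorics.Permutations"
begin

definition linear_on :: "'a::real_vector set \<Rightarrow> ('a \<Rightarrow> 'b::real_vector) \<Rightarrow> bool" where
  "linear_on S f \<longleftrightarrow>
     (\<forall>x\<in>S. \<forall>y\<in>S. f (x + y) = f x + f y) \<and> (\<forall>c. \<forall>x\<in>S. f (c *\<^sub>R x) = c *\<^sub>R f x)"

definition bilinear_on :: "'a::real_vector set \<Rightarrow> ('a \<Rightarrow> 'a \<Rightarrow> 'b::real_vector) \<Rightarrow> bool" where
  "bilinear_on S f \<longleftrightarrow> (\<forall>x\<in>S. linear_on S (\<lambda>y. f x y)) \<and> (\<forall>y\<in>S. linear_on S (\<lambda>x. f x y))"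

locale fin_dim_lie_algebra =
  fixes L :: "'a::real_vector set" and b :: "'a \<Rightarrow> 'a \<Rightarrow> 'a"
  assumes subspace: "subspace L"
    and finite_dimensional: "\<exists>B. finite B \<and> L \<subseteq> span B"
    and bracket_closed: "\<lbrakk>x \<in> L; y \<in> L\<rbrakk> \<Longrightarrow> b x y \<in> L"
    and bracket_bilinear: "bilinear_on L b"
    and bracket_self: "x \<in> L \<Longrightarrow> b x x = 0"
    and jacobi: "\<lbrakk>x \<in> L; y \<in> L; z \<in> L\<rbrakk> \<Longrightarrow> b x (b y z) + b y (b z x) + b z (b x y) = 0"

text \<open>
  A triple lives on a linear subspace \<open>carr\<close> of an ambient real vector space, so that the summands
  of a direct sum are again triples over the same type. The operations are relevant on the carrier
  only (the form only on the \<open>-1\<close> eigenspace of the involution); their other values are arbitrary.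
\<close>

record 'a triple =
  carr :: "'a set"
  br :: "'a \<Rightarrow> 'a \<Rightarrow> 'a"
  invol :: "'a \<Rightarrow> 'a"
  form :: "'a \<Rightarrow> 'a \<Rightarrow> real"

definition K_part :: "'a::real_vector triple \<Rightarrow> 'a set" where
  "K_part t = {x \<in> carr t. invol t x = x}"

definition P_part :: "'a::real_vector triple \<Rightarrow> 'a set" where
  "P_part t = {x \<in> carr t. invol t x = - x}"

text \<open>
  The splitting of the carrier as \<open>K_part t \<oplus> P_part t\<close> is a consequence of
  \<open>invol_linear\<close> and \<open>invol_involutive\<close>.
\<close>

locale symplectic_symmetric_triple =
  fixes t :: "'a::real_vector triple"
  assumes lie_algebra: "fin_dim_lie_algebra (carr t) (br t)"
    and invol_closed: "x \<in> carr t \<Longrightarrow> invol t x \<in> carr t"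
    and invol_linear: "linear_on (carr t) (invol t)"
    and invol_bracket:
      "\<lbrakk>x \<in> carr t; y \<in> carr t\<rbrakk> \<Longrightarrow> invol t (br t x y) = br t (invol t x) (invol t y)"
    and invol_involutive: "x \<in> carr t \<Longrightarrow> invol t (invol t x) = x"
    and K_generated: "span {br t x y | x y. x \<in> P_part t \<and> y \<in> P_part t} = K_part t"
    and K_faithful: "\<lbrakk>k \<in> K_part t; \<And>x. x \<in> P_part t \<Longrightarrow> br t k x = 0\<rbrakk> \<Longrightarrow> k = 0"
    and form_bilinear: "bilinear_on (P_part t) (form t)"
    and form_alternating: "x \<in> P_part t \<Longrightarrow> form t x x = 0"
    and form_nondegenerate:
      "\<lbrakk>x \<in> P_part t; \<And>y. y \<in> P_part t \<Longrightarrow> form t x y = 0\<rbrakk> \<Longrightarrow> x = 0"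
    and form_invariant:
      "\<lbrakk>k \<in> K_part t; x \<in> P_part t; y \<in> P_part t\<rbrakk>
       \<Longrightarrow> form t (br t k x) y + form t x (br t k y) = 0"

definition flat :: "'a::real_vector triple \<Rightarrow> bool" where
  "flat t \<longleftrightarrow> K_part t = {0}"

text \<open>An isomorphism of \<open>s\<close> onto \<open>t\<close>; in particular \<open>\<phi> ` carr s = carr t\<close>.\<close>

definition triple_iso ::
    "('a::real_vector \<Rightarrow> 'b::real_vector) \<Rightarrow> 'a triple \<Rightarrow> 'b triple \<Rightarrow> bool" where
  "triple_iso \<phi> s t \<longleftrightarrow>
     bij_betw \<phi> (carr s) (carr t) \<and>
     linear_on (carr s) \<phi> \<and>
     (\<forall>x\<in>carr s. \<forall>y\<in>carr s. \<phi> (br s x y) = br t (\<phi> x) (\<phi> y)) \<and>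
     (\<forall>x\<in>carr s. \<phi> (invol s x) = invol t (\<phi> x)) \<and>
     (\<forall>x\<in>P_part s. \<forall>y\<in>P_part s. form t (\<phi> x) (\<phi> y) = form s x y)"

definition triple_automorphism :: "('a::real_vector \<Rightarrow> 'a) \<Rightarrow> 'a triple \<Rightarrow> bool" where
  "triple_automorphism \<phi> t \<longleftrightarrow> triple_iso \<phi> t t"

definition stable_ideal_triple :: "'a::real_vector triple \<Rightarrow> 'a triple \<Rightarrow> bool" where
  "stable_ideal_triple u t \<longleftrightarrow>
     subspace (carr u) \<and> carr u \<subseteq> carr t \<and>
     (\<forall>x\<in>carr t. \<forall>y\<in>carr u. br t x y \<in> carr u) \<and>
     (\<forall>x\<in>carr u. invol t x \<in> carr u) \<and>
     (\<forall>x\<in>carr u. \<forall>y\<in>carr u. br u x y = br t x y) \<and>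
     (\<forall>x\<in>carr u. invol u x = invol t x) \<and>
     (\<forall>x\<in>P_part u. \<forall>y\<in>P_part u. form u x y = form t x y)"

definition direct_sum_of :: "'a::real_vector triple \<Rightarrow> 'i set \<Rightarrow> ('i \<Rightarrow> 'a triple) \<Rightarrow> bool" where
  "direct_sum_of t I s \<longleftrightarrow>
     finite I \<and>
     (\<forall>i\<in>I. symplectic_symmetric_triple (s i) \<and> stable_ideal_triple (s i) t) \<and>
     (\<forall>x\<in>carr t. \<exists>!f. f \<in> (\<Pi>\<^sub>E i\<in>I. carr (s i)) \<and> x = (\<Sum>i\<in>I. f i)) \<and>
     (\<forall>i\<in>I. \<forall>j\<in>I. i \<noteq> j \<longrightarrow> (\<forall>x\<in>P_part (s i). \<forall>y\<in>P_part (s j). form t x y = 0))"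

definition decomposable :: "'a::real_vector triple \<Rightarrow> bool" where
  "decomposable t \<longleftrightarrow>
     (\<exists>s. direct_sum_of t {1, 2 :: nat} s \<and> carr (s 1) \<noteq> {0} \<and> carr (s 2) \<noteq> {0})"

definition indecomposable :: "'a::real_vector triple \<Rightarrow> bool" where
  "indecomposable t \<longleftrightarrow> \<not> decomposable t"

end

theory Submission
  imports Defs
begin

text \<open>
  The proof is of Krull--Schmidt type and takes place in the centroid of \<open>t\<close>: the endomorphisms
  \<open>f\<close> of the Lie algebra that commute with the involution and satisfy \<open>f [x, y] = [f x, y]\<close>. The
  projections \<open>\<pi>\<^sub>\<alpha>\<close> and \<open>\<pi>'\<^sub>\<beta>\<close> of the two decompositions belong to it, and they are self-adjoint for
  \<open>\<Omega>\<close>. Two properties of the centroid carry the argument. Its elements commute with one another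
  on \<open>K\<close>, because \<open>f (g [x, y]) = [f x, g y] = g (f [x, y])\<close> and such brackets span \<open>K\<close>; and an
  element that vanishes on \<open>K\<close> takes central values on \<open>P\<close>.

  Self-adjoint idempotents of the centroid correspond to splittings of the triple, so those of an
  indecomposable triple are \<open>0\<close> and \<open>1\<close> (\<open>sa_idempotent_trivial\<close>). If the triple is moreover not
  flat, its centre is isotropic (\<open>central_part_isotropic\<close>): a hyperbolic plane of central vectors
  would split off. Hence a self-adjoint centroid element vanishing on \<open>K\<close> has square zero, and an
  element that is idempotent only on \<open>K\<close> can be corrected to a true idempotent; so it is \<open>0\<close>
  or \<open>1\<close> on \<open>K\<close> (\<open>idempotent_on_K_trivial\<close>).

  For non-flat \<open>t\<^sub>\<alpha>\<close> this applies to \<open>\<pi>\<^sub>\<alpha> \<pi>'\<^sub>\<beta>\<close> on \<open>t\<^sub>\<alpha>\<close>, which agrees with \<open>\<pi>'\<^sub>\<beta>\<close> on \<open>K\<^sub>\<alpha>\<close>. Since the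
  \<open>\<pi>'\<^sub>\<beta>\<close> add up to the identity, \<open>K\<^sub>\<alpha>\<close> lies in a single \<open>K'\<^sub>\<beta>\<close>. By symmetry there is a bijection \<open>\<eta>\<close>
  with \<open>K\<^sub>\<alpha> = K'\<^sub>\<eta>\<^sub>\<alpha>\<close>, and in particular \<open>p = q\<close>.

  It remains to match the summands themselves. The map \<open>\<psi> = \<Sum>\<^sub>\<alpha> \<pi>'\<^sub>\<eta>\<^sub>\<alpha> \<pi>\<^sub>\<alpha>\<close>, with \<open>\<eta> 0 = 0\<close>, carries \<open>t\<^sub>\<alpha>\<close>
  into \<open>t'\<^sub>\<eta>\<^sub>\<alpha>\<close> and is the identity on \<open>K\<close>, but it need not preserve \<open>\<Omega>\<close>. The defect is
  \<open>\<psi>\<^sup>* \<psi> = 1 + n\<close>, where \<open>n\<close> is a self-adjoint centroid element vanishing on \<open>K\<close>. On non-flat summands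
  its values lie in an isotropic space, and on the flat summand it is zero, so \<open>n\<^sup>2 = 0\<close>. As
  \<open>(1 + n)\<^sup>-\<^sup>1\<^sup>/\<^sup>2 = 1 - n/2\<close>, the map \<open>\<phi> = \<psi> (1 - n/2)\<close> is an isometry on \<open>P\<close>. Being a centroid element
  that is the identity on \<open>K\<close>, it is then an automorphism
  (\<open>isometry_in_centroid_automorphism\<close>), and it maps \<open>t\<^sub>\<alpha>\<close> onto \<open>t'\<^sub>\<eta>\<^sub>\<alpha>\<close>.
\<close>

section \<open>Linear maps on a subspace\<close>

lemma linear_on_add: "linear_on S f \<Longrightarrow> x \<in> S \<Longrightarrow> y \<in> S \<Longrightarrow> f (x + y) = f x + f y"
  and linear_on_scale: "linear_on S f \<Longrightarrow> x \<in> S \<Longrightarrow> f (c *\<^sub>R x) = c *\<^sub>R f x"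
  by (auto simp: linear_on_def)

lemma linear_on_minus: "linear_on S f \<Longrightarrow> x \<in> S \<Longrightarrow> f (- x) = - f x"
  using linear_on_scale[of S f x "-1"] by simp

lemma linear_on_diff:
  assumes "linear_on S f" "subspace S" "x \<in> S" "y \<in> S"
  shows "f (x - y) = f x - f y"
  using linear_on_add[OF assms(1) assms(3) subspace_neg[OF assms(2,4)]]
    linear_on_minus[OF assms(1,4)] by simp

lemma linear_on_zero: "linear_on S f \<Longrightarrow> subspace S \<Longrightarrow> f 0 = 0"
  using linear_on_scale[of S f 0 0] by (simp add: subspace_0)

lemma linear_on_sum:
  assumes "linear_on S f" "subspace S" "\<And>i. i \<in> I \<Longrightarrow> g i \<in> S"
  shows "f (\<Sum>i\<in>I. g i) = (\<Sum>i\<in>I. f (g i))"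
  using assms(3)
proof (induction I rule: infinite_finite_induct)
  case (insert a I)
  have "(\<Sum>i\<in>I. g i) \<in> S"
    by (rule subspace_sum[OF assms(2)]) (use insert in auto)
  then show ?case
    using insert linear_on_add[OF assms(1), of "g a" "\<Sum>i\<in>I. g i"] by simp
qed (auto intro: linear_on_zero[OF assms(1,2)])

lemma linear_on_subset: "linear_on S f \<Longrightarrow> U \<subseteq> S \<Longrightarrow> linear_on U f"
  unfolding linear_on_def by blast

lemma bilinear_on_subset: "bilinear_on S f \<Longrightarrow> U \<subseteq> S \<Longrightarrow> bilinear_on U f"
  unfolding bilinear_on_def using linear_on_subset by blast

text \<open>
  Rank and nullity for a map that is linear only on a subspace of an ambient space of arbitrary
  dimension: the map is extended linearly from a basis, and if some \<open>y\<close> were missed by the image,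
  the image of the basis together with \<open>y\<close> would be an independent set that is too large.
\<close>

lemma linear_on_inj_imp_bij_betw:
  assumes lin: "linear_on S f" and sub: "subspace S" and fin: "finite B" "S \<subseteq> span B"
    and maps: "\<And>x. x \<in> S \<Longrightarrow> f x \<in> S"
    and ker: "\<And>x. x \<in> S \<Longrightarrow> f x = 0 \<Longrightarrow> x = 0"
  shows "bij_betw f S S"
proof -
  obtain C where C: "C \<subseteq> S" "independent C" "S \<subseteq> span C"
    using maximal_independent_subset[of S] by blast
  have finC: "finite C"
    using independent_span_bound[OF fin(1) C(2)] C(1) fin(2) by blast
  have span_C: "span C = S"
    using C sub by (simp add: span_subspace)
  obtain g where g: "linear g" "\<And>x. x \<in> C \<Longrightarrow> g x = f x"
    using linear_independent_extend[OF C(2), of f] by blast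
  have g_eq: "g x = f x" if "x \<in> S" for x
  proof -
    have "x \<in> span C" using that C by blast
    then have "x \<in> S \<and> g x = f x"
    proof (induction rule: span_induct_alt)
      case base
      show ?case using g(1) linear_on_zero[OF lin sub] sub
        by (simp add: linear_0 subspace_0)
    next
      case (step c x y)
      then have "x \<in> S" "c *\<^sub>R x \<in> S" "y \<in> S" using C sub by (auto intro: subspace_scale)
      then show ?case using step g sub
        by (simp add: linear_add linear_scale linear_on_add[OF lin] linear_on_scale[OF lin]
            subspace_add)
    qed
    then show ?thesis by simp
  qed
  have inj: "inj_on f S"
  proof (rule inj_onI)
    fix x y assume "x \<in> S" "y \<in> S" "f x = f y"
    then have "x - y = 0"
      using ker[of "x - y"] linear_on_diff[OF lin sub] sub by (simp add: subspace_diff)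
    then show "x = y" by simp
  qed
  then have inj_g: "inj_on g (span C)"
    using g_eq span_C by (simp add: inj_on_def)
  have ind: "independent (g ` C)"
    using linear_independent_injective_image[OF g(1) C(2) inj_g] .
  have card: "card (g ` C) = card C"
    using inj_g by (meson card_image inj_on_subset span_superset)
  have gC: "g ` C \<subseteq> S" using C(1) g maps by auto
  have "S \<subseteq> span (g ` C)"
  proof (rule ccontr)
    assume "\<not> S \<subseteq> span (g ` C)"
    then obtain y where y: "y \<in> S" "y \<notin> span (g ` C)" by blast
    have "independent (insert y (g ` C))"
      using independent_insertI[OF y(2) ind] .
    then have "card (insert y (g ` C)) \<le> card C"
      using independent_span_bound[OF finC] gC y(1) span_C by blast
    moreover have "y \<notin> g ` C" using y(2) span_base[of y] by metis
    ultimately show False using finC card by simp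
  qed
  also have "span (g ` C) = g ` S"
    using span_C linear_span_image[OF g(1)] by metis
  finally have "S \<subseteq> f ` S" using g_eq by auto
  then show ?thesis using inj maps by (auto simp: bij_betw_def)
qed

section \<open>Symplectic symmetric triples and their centroid\<close>

definition centroid :: "'a::real_vector triple \<Rightarrow> ('a \<Rightarrow> 'a) set" where
  "centroid t = {f. (\<forall>x\<in>carr t. f x \<in> carr t) \<and> linear_on (carr t) f \<and>
     (\<forall>x\<in>carr t. f (invol t x) = invol t (f x)) \<and>
     (\<forall>x\<in>carr t. \<forall>y\<in>carr t. f (br t x y) = br t (f x) y)}"

text \<open>
  The self-adjoint elements of the centroid; adjoints refer to the form, which lives on the
  \<open>P\<close>-part.
\<close>

definition sa_centroid :: "'a::real_vector triple \<Rightarrow> ('a \<Rightarrow> 'a) set" where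
  "sa_centroid t = {f \<in> centroid t. \<forall>x\<in>P_part t. \<forall>y\<in>P_part t. form t (f x) y = form t x (f y)}"

text \<open>
  The intersection of the centre of the Lie algebra with the \<open>P\<close>-part. By faithfulness of the
  action of \<open>K\<close> it is the whole centre.
\<close>

definition central_part :: "'a::real_vector triple \<Rightarrow> 'a set" where
  "central_part t = {z \<in> P_part t. \<forall>y\<in>carr t. br t z y = 0}"

lemma sa_centroid_centroid: "f \<in> sa_centroid t \<Longrightarrow> f \<in> centroid t"
  by (simp add: sa_centroid_def)

lemma sa_centroid_form:
  "f \<in> sa_centroid t \<Longrightarrow> x \<in> P_part t \<Longrightarrow> y \<in> P_part t \<Longrightarrow> form t (f x) y = form t x (f y)"
  by (simp add: sa_centroid_def)

context symplectic_symmetric_triple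
begin

lemma subspace_carr: "subspace (carr t)"
  and br_closed: "x \<in> carr t \<Longrightarrow> y \<in> carr t \<Longrightarrow> br t x y \<in> carr t"
  and br_self: "x \<in> carr t \<Longrightarrow> br t x x = 0"
  and br_linear_right: "x \<in> carr t \<Longrightarrow> linear_on (carr t) (br t x)"
  and br_linear_left: "y \<in> carr t \<Longrightarrow> linear_on (carr t) (\<lambda>x. br t x y)"
  and finite_span: "\<exists>B. finite B \<and> carr t \<subseteq> span B"
  using lie_algebra by (auto simp: fin_dim_lie_algebra_def bilinear_on_def)

lemmas carr_intros =
  subspace_0[OF subspace_carr] subspace_add[OF subspace_carr] subspace_diff[OF subspace_carr]
  subspace_scale[OF subspace_carr] subspace_neg[OF subspace_carr]
  subspace_sum[OF subspace_carr] br_closed invol_closed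

lemmas invol_add = linear_on_add[OF invol_linear]
  and invol_scale = linear_on_scale[OF invol_linear]
  and invol_diff = linear_on_diff[OF invol_linear subspace_carr]
  and invol_zero = linear_on_zero[OF invol_linear subspace_carr]

lemmas br_add_left = linear_on_add[OF br_linear_left]
  and br_add_right = linear_on_add[OF br_linear_right]
  and br_minus_left = linear_on_minus[OF br_linear_left]
  and br_minus_right = linear_on_minus[OF br_linear_right]

lemma br_skew:
  assumes "x \<in> carr t" "y \<in> carr t" shows "br t x y = - br t y x"
proof -
  have "0 = br t (x + y) (x + y)" using assms by (simp add: br_self carr_intros)
  also have "\<dots> = br t x y + br t y x"
    using assms br_self[OF assms(1)] br_self[OF assms(2)]
    by (simp add: br_add_left br_add_right carr_intros)
  finally show ?thesis by (simp add: eq_neg_iff_add_eq_0)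
qed

lemma P_carr: "x \<in> P_part t \<Longrightarrow> x \<in> carr t"
  and K_carr: "x \<in> K_part t \<Longrightarrow> x \<in> carr t"
  by (auto simp: P_part_def K_part_def)

lemma subspace_P: "subspace (P_part t)"
  by (rule subspaceI) (auto simp: P_part_def carr_intros invol_add invol_scale invol_zero)

lemma subspace_K: "subspace (K_part t)"
  by (rule subspaceI) (auto simp: K_part_def carr_intros invol_add invol_scale invol_zero)

lemmas P_intros =
  subspace_0[OF subspace_P] subspace_add[OF subspace_P] subspace_diff[OF subspace_P]
  subspace_scale[OF subspace_P] subspace_neg[OF subspace_P] subspace_sum[OF subspace_P]

lemma br_PP: "x \<in> P_part t \<Longrightarrow> y \<in> P_part t \<Longrightarrow> br t x y \<in> K_part t"
  and br_KP: "k \<in> K_part t \<Longrightarrow> x \<in> P_part t \<Longrightarrow> br t k x \<in> P_part t"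
  by (auto simp: P_part_def K_part_def carr_intros invol_bracket br_minus_left br_minus_right)

lemma K_plus_P:
  assumes "x \<in> carr t"
  obtains k v where "k \<in> K_part t" "v \<in> P_part t" "x = k + v"
proof
  show "(1/2) *\<^sub>R (x + invol t x) \<in> K_part t"
    using assms by (simp add: K_part_def carr_intros invol_add invol_scale invol_involutive add.commute)
  show "(1/2) *\<^sub>R (x - invol t x) \<in> P_part t"
    using assms
    by (simp add: P_part_def carr_intros invol_diff invol_scale invol_involutive
        flip: scaleR_minus_right)
  show "x = (1/2) *\<^sub>R (x + invol t x) + (1/2) *\<^sub>R (x - invol t x)"
    by (simp add: algebra_simps flip: scaleR_add_left)
qed

lemma form_linear_right: "x \<in> P_part t \<Longrightarrow> linear_on (P_part t) (form t x)"
  and form_linear_left: "y \<in> P_part t \<Longrightarrow> linear_on (P_part t) (\<lambda>x. form t x y)"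
  using form_bilinear by (auto simp: bilinear_on_def)

lemmas form_add_left = linear_on_add[OF form_linear_left]
  and form_add_right = linear_on_add[OF form_linear_right]
  and form_diff_left = linear_on_diff[OF form_linear_left subspace_P]
  and form_diff_right = linear_on_diff[OF form_linear_right subspace_P]
  and form_scale_left = linear_on_scale[OF form_linear_left]
  and form_scale_right = linear_on_scale[OF form_linear_right]
  and form_sum_left = linear_on_sum[OF form_linear_left subspace_P]
  and form_sum_right = linear_on_sum[OF form_linear_right subspace_P]
  and form_zero_left = linear_on_zero[OF form_linear_left subspace_P]
  and form_zero_right = linear_on_zero[OF form_linear_right subspace_P]

lemma form_skew:
  assumes "x \<in> P_part t" "y \<in> P_part t" shows "form t x y = - form t y x"
proof -
  have "0 = form t (x + y) (x + y)" using assms by (simp add: form_alternating P_intros)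
  also have "\<dots> = form t x y + form t y x"
    using assms form_alternating[OF assms(1)] form_alternating[OF assms(2)]
    by (simp add: form_add_left form_add_right P_intros)
  finally show ?thesis by simp
qed

lemma K_induct [consumes 1, case_names bracket zero add scale]:
  assumes "k \<in> K_part t"
    and br: "\<And>x y. x \<in> P_part t \<Longrightarrow> y \<in> P_part t \<Longrightarrow> Q (br t x y)"
    and zero: "Q 0"
    and add: "\<And>k l. k \<in> K_part t \<Longrightarrow> l \<in> K_part t \<Longrightarrow> Q k \<Longrightarrow> Q l \<Longrightarrow> Q (k + l)"
    and scale: "\<And>c k. k \<in> K_part t \<Longrightarrow> Q k \<Longrightarrow> Q (c *\<^sub>R k)"
  shows "Q k"
proof -
  have "k \<in> span {br t x y | x y. x \<in> P_part t \<and> y \<in> P_part t}"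
    using assms(1) K_generated by simp
  then have "k \<in> K_part t \<and> Q k"
  proof (induction rule: span_induct_alt)
    case base
    show ?case using zero subspace_K by (simp add: subspace_0)
  next
    case (step c x y)
    then have "x \<in> K_part t" "Q x" "y \<in> K_part t" "Q y" using br br_PP by auto
    then show ?case using add scale subspace_K by (simp add: subspace_add subspace_scale)
  qed
  then show ?thesis ..
qed

lemma centroidI:
  assumes "\<And>x. x \<in> carr t \<Longrightarrow> f x \<in> carr t" "linear_on (carr t) f"
    "\<And>x. x \<in> carr t \<Longrightarrow> f (invol t x) = invol t (f x)"
    "\<And>x y. x \<in> carr t \<Longrightarrow> y \<in> carr t \<Longrightarrow> f (br t x y) = br t (f x) y"
  shows "f \<in> centroid t"
  using assms by (auto simp: centroid_def)

lemma centroid_closed: "f \<in> centroid t \<Longrightarrow> x \<in> carr t \<Longrightarrow> f x \<in> carr t"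
  and centroid_linear: "f \<in> centroid t \<Longrightarrow> linear_on (carr t) f"
  and centroid_invol: "f \<in> centroid t \<Longrightarrow> x \<in> carr t \<Longrightarrow> f (invol t x) = invol t (f x)"
  and centroid_br_left:
    "f \<in> centroid t \<Longrightarrow> x \<in> carr t \<Longrightarrow> y \<in> carr t \<Longrightarrow> br t (f x) y = f (br t x y)"
  by (auto simp: centroid_def)

lemmas centroid_add = linear_on_add[OF centroid_linear]
  and centroid_scale = linear_on_scale[OF centroid_linear]
  and centroid_diff = linear_on_diff[OF centroid_linear subspace_carr]
  and centroid_minus = linear_on_minus[OF centroid_linear]
  and centroid_zero = linear_on_zero[OF centroid_linear subspace_carr]
  and centroid_sum_arg = linear_on_sum[OF centroid_linear subspace_carr]

lemma centroid_br_right: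
  assumes f: "f \<in> centroid t" and xy: "x \<in> carr t" "y \<in> carr t"
  shows "br t x (f y) = f (br t x y)"
proof -
  have "br t x (f y) = - f (br t y x)"
    using xy br_skew[of x "f y"]
    by (simp add: centroid_closed[OF f] centroid_br_left[OF f])
  also have "\<dots> = f (br t x y)"
    using xy br_skew[of x y] by (simp add: centroid_minus[OF f] carr_intros)
  finally show ?thesis .
qed

lemmas centroid_simps =
  centroid_closed centroid_add centroid_scale centroid_diff centroid_minus centroid_zero
  centroid_invol centroid_br_left centroid_br_right

lemma centroid_P:
  assumes f: "f \<in> centroid t" and x: "x \<in> P_part t"
  shows "f x \<in> P_part t"
  using x centroid_invol[OF f, of x] by (auto simp: P_part_def centroid_simps[OF f])

lemma centroid_K:
  assumes f: "f \<in> centroid t" and x: "x \<in> K_part t"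
  shows "f x \<in> K_part t"
  using x centroid_invol[OF f, of x] by (auto simp: K_part_def centroid_simps[OF f])

lemma centroid_id: "(\<lambda>x. x) \<in> centroid t"
  by (auto simp: centroid_def linear_on_def)

lemma centroid_comp:
  assumes f: "f \<in> centroid t" and g: "g \<in> centroid t"
  shows "(\<lambda>x. f (g x)) \<in> centroid t"
  by (intro centroidI) (auto simp: linear_on_def centroid_simps[OF f] centroid_simps[OF g] carr_intros)

lemma centroid_plus:
  assumes f: "f \<in> centroid t" and g: "g \<in> centroid t"
  shows "(\<lambda>x. f x + g x) \<in> centroid t"
  by (intro centroidI)
    (auto simp: linear_on_def centroid_simps[OF f] centroid_simps[OF g] carr_intros
      invol_add br_add_left scaleR_add_right)

lemma centroid_scaleR:
  assumes f: "f \<in> centroid t"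
  shows "(\<lambda>x. c *\<^sub>R f x) \<in> centroid t"
  by (intro centroidI)
    (auto simp: linear_on_def centroid_simps[OF f] carr_intros invol_scale
      linear_on_scale[OF br_linear_left] scaleR_add_right)

lemma centroid_minus_fun:
  assumes "f \<in> centroid t" "g \<in> centroid t" shows "(\<lambda>x. f x - g x) \<in> centroid t"
  using centroid_plus[OF assms(1) centroid_scaleR[OF assms(2), of "-1"]] by simp

lemma centroid_sum:
  assumes "\<And>i. i \<in> I \<Longrightarrow> f i \<in> centroid t" shows "(\<lambda>x. \<Sum>i\<in>I. f i x) \<in> centroid t"
  using assms
proof (induction I rule: infinite_finite_induct)
  case (insert a I)
  then show ?case using centroid_plus[of "f a" "\<lambda>x. \<Sum>i\<in>I. f i x"] by simp
qed (use centroid_scaleR[OF centroid_id, of 0] in simp_all)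

text \<open>
  In \<open>f (g [x, y])\<close> the map \<open>g\<close> can be moved onto \<open>y\<close> and \<open>f\<close> onto \<open>x\<close>, and then both can be taken
  out again in the other order.
\<close>

lemma centroid_commute_on_K:
  assumes f: "f \<in> centroid t" and g: "g \<in> centroid t" and k: "k \<in> K_part t"
  shows "f (g k) = g (f k)"
  using k
proof (induction rule: K_induct)
  case (bracket x y)
  then have c: "x \<in> carr t" "y \<in> carr t" by (auto simp: P_carr)
  have "f (g (br t x y)) = f (br t x (g y))"
    using c by (simp add: centroid_br_right[OF g])
  also have "\<dots> = br t (f x) (g y)"
    using c by (simp add: centroid_br_left[OF f] centroid_closed[OF g])
  also have "\<dots> = g (br t (f x) y)"
    using c by (simp add: centroid_br_right[OF g] centroid_closed[OF f])
  also have "\<dots> = g (f (br t x y))"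
    using c by (simp add: centroid_br_left[OF f])
  finally show ?case .
qed (auto simp: centroid_simps[OF f] centroid_simps[OF g] K_carr)

text \<open>
  For \<open>x\<close> and \<open>v\<close> in \<open>P\<close>, the bracket \<open>[f x, v] = f [x, v]\<close> vanishes since \<open>[x, v]\<close> lies in \<open>K\<close>; and
  for \<open>k\<close> in \<open>K\<close>, \<open>[f x, k] = [x, f k] = 0\<close>.
\<close>

lemma centroid_zero_on_K_imp_central:
  assumes f: "f \<in> centroid t" and fK: "\<And>k. k \<in> K_part t \<Longrightarrow> f k = 0" and x: "x \<in> P_part t"
  shows "f x \<in> central_part t"
proof -
  have "br t (f x) y = 0" if y: "y \<in> carr t" for y
  proof -
    obtain k v where kv: "k \<in> K_part t" "v \<in> P_part t" "y = k + v"
      using K_plus_P[OF y] .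
    have "br t (f x) k = br t x (f k)"
      using x kv by (simp add: centroid_br_left[OF f] centroid_br_right[OF f] P_carr K_carr)
    also have "\<dots> = 0"
      using fK[OF kv(1)] x linear_on_zero[OF br_linear_right subspace_carr] by (simp add: P_carr)
    finally have "br t (f x) k = 0" .
    moreover have "br t (f x) v = 0"
      using fK[OF br_PP[OF x kv(2)]] x kv by (simp add: centroid_br_left[OF f] P_carr)
    ultimately show ?thesis
      using kv x by (simp add: br_add_right P_carr K_carr centroid_closed[OF f])
  qed
  then show ?thesis using centroid_P[OF f x] by (simp add: central_part_def)
qed

lemma central_part_centroid:
  assumes f: "f \<in> centroid t" and z: "z \<in> central_part t"
  shows "f z \<in> central_part t"
  using z by (auto simp: central_part_def centroid_P[OF f] centroid_br_left[OF f] P_carr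
      centroid_zero[OF f])

lemma sa_centroidI:
  assumes "f \<in> centroid t"
    "\<And>x y. x \<in> P_part t \<Longrightarrow> y \<in> P_part t \<Longrightarrow> form t (f x) y = form t x (f y)"
  shows "f \<in> sa_centroid t"
  using assms by (simp add: sa_centroid_def)

text \<open>
  A centroid element is far from being a homomorphism in general, since
  \<open>[f x, f y] = f (f [x, y])\<close>. Here the two extra factors are harmless: \<open>f\<close> is the identity on
  \<open>[P, P]\<close>, and in brackets that involve \<open>K\<close> one of the two arguments is fixed by \<open>f\<close>.
  Non-degeneracy of the form makes \<open>f\<close> injective on \<open>P\<close>, hence injective.
\<close>

lemma isometry_in_centroid_automorphism:
  assumes f: "f \<in> centroid t" and fK: "\<And>k. k \<in> K_part t \<Longrightarrow> f k = k"
    and iso: "\<And>x y. x \<in> P_part t \<Longrightarrow> y \<in> P_part t \<Longrightarrow> form t (f x) (f y) = form t x y"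
  shows "triple_automorphism f t"
proof -
  have ker: "x = 0" if x: "x \<in> carr t" "f x = 0" for x
  proof -
    obtain k v where kv: "k \<in> K_part t" "v \<in> P_part t" "x = k + v"
      using K_plus_P[OF x(1)] .
    have eq: "k + f v = 0" using x kv fK by (simp add: centroid_add[OF f] K_carr P_carr)
    \<comment> \<open>Applying the involution to \<open>k + f v = 0\<close> separates the two parts.\<close>
    have "invol t (k + f v) = k - f v"
      using kv centroid_P[OF f kv(2)]
      by (simp add: invol_add K_carr P_carr centroid_closed[OF f]) (simp add: K_part_def P_part_def)
    then have "k - f v = 0" using eq invol_zero by simp
    with eq have "k + k = 0" by (metis add_diff_cancel_left' diff_add_cancel diff_zero)
    then have "k = 0" by (metis scaleR_2 scaleR_eq_0_iff zero_neq_numeral)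
    then have fv: "f v = 0" using eq by simp
    have "form t v y = 0" if "y \<in> P_part t" for y
      using iso[OF kv(2) that] fv centroid_P[OF f that] by (simp add: form_zero_left)
    then show "x = 0" using kv \<open>k = 0\<close> form_nondegenerate by simp
  qed
  obtain B where "finite B" "carr t \<subseteq> span B" using finite_span by blast
  then have bij: "bij_betw f (carr t) (carr t)"
    using linear_on_inj_imp_bij_betw[OF centroid_linear[OF f] subspace_carr]
      ker centroid_closed[OF f] by blast
  have hom: "f (br t x y) = br t (f x) (f y)" if xy: "x \<in> carr t" "y \<in> carr t" for x y
  proof -
    obtain k v where kv: "k \<in> K_part t" "v \<in> P_part t" "x = k + v" using K_plus_P[OF xy(1)] .
    obtain l w where lw: "l \<in> K_part t" "w \<in> P_part t" "y = l + w" using K_plus_P[OF xy(2)] .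
    have c: "k \<in> carr t" "v \<in> carr t" "l \<in> carr t" "w \<in> carr t" "f v \<in> carr t" "f w \<in> carr t"
      using kv lw f by (auto simp: K_carr P_carr centroid_closed[OF f])
    have kl: "f (br t k l) = br t k l" using centroid_br_left[OF f c(1,3)] fK[OF kv(1)] by simp
    have kw: "br t k (f w) = f (br t k w)" using c by (simp add: centroid_br_right[OF f])
    have vl: "br t (f v) l = f (br t v l)" using c by (simp add: centroid_br_left[OF f])
    have vw: "br t (f v) (f w) = br t v w"
      using c fK[OF br_PP[OF kv(2) lw(2)]] by (simp add: centroid_br_left[OF f] centroid_br_right[OF f])
    show ?thesis
      using kv lw c kl kw vl vw fK
      by (simp add: centroid_add[OF f] br_add_left br_add_right carr_intros)
        (simp add: vw centroid_br_left[OF f] centroid_br_right[OF f] fK br_PP)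
  qed
  show ?thesis
    unfolding triple_automorphism_def triple_iso_def
    using bij hom iso by (auto simp: centroid_linear[OF f] centroid_invol[OF f])
qed


section \<open>Idempotents of the centroid and indecomposability\<close>

text \<open>
  The fixed space of \<open>e\<close> inherits every axiom because \<open>e\<close> can be inserted in any argument: for
  \<open>k\<close> in the fixed space, \<open>[k, x] = [k, e x]\<close>, and likewise \<open>\<Omega>(x, y) = \<Omega>(x, e y)\<close>, so testing
  against the fixed space is the same as testing against everything. Brackets still generate
  since \<open>e [x, y] = [e x, e y]\<close>. The lemma covers the kernel as well, which is the fixed space
  of \<open>1 - e\<close>.
\<close>

lemma sa_idempotent_image:
  assumes e: "e \<in> sa_centroid t" and idem: "\<And>x. x \<in> carr t \<Longrightarrow> e (e x) = e x"
  defines "u \<equiv> t\<lparr>carr := {x \<in> carr t. e x = x}\<rparr>"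
  shows "symplectic_symmetric_triple u" "stable_ideal_triple u t"
proof -
  note ec = sa_centroid_centroid[OF e]
  note es = centroid_simps[OF ec]
  have carr_u: "carr u = {x \<in> carr t. e x = x}" "carr u \<subseteq> carr t" and br_u: "br u = br t"
    and invol_u: "invol u = invol t" and form_u: "form u = form t"
    by (auto simp: u_def)
  have P_u: "P_part u = {x \<in> P_part t. e x = x}" and K_u: "K_part u = {x \<in> K_part t. e x = x}"
    by (auto simp: P_part_def K_part_def carr_u invol_u)
  have sub: "subspace (carr u)"
    by (rule subspaceI) (auto simp: carr_u es carr_intros)
  have eP: "e x \<in> P_part u" if "x \<in> P_part t" for x
    using that idem by (simp add: P_u centroid_P[OF ec] P_carr)
  show "symplectic_symmetric_triple u"
  proof (rule symplectic_symmetric_triple.intro)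
    show "fin_dim_lie_algebra (carr u) (br u)"
    proof (rule fin_dim_lie_algebra.intro)
      show "\<exists>B. finite B \<and> carr u \<subseteq> span B" using finite_span carr_u(2) by blast
      show "bilinear_on (carr u) (br u)"
        using bilinear_on_subset[OF fin_dim_lie_algebra.bracket_bilinear[OF lie_algebra] carr_u(2)]
        by (simp add: br_u)
      show "br u x (br u y z) + br u y (br u z x) + br u z (br u x y) = 0"
        if "x \<in> carr u" "y \<in> carr u" "z \<in> carr u" for x y z
        using that fin_dim_lie_algebra.jacobi[OF lie_algebra, of x y z] by (simp add: carr_u br_u)
      show "subspace (carr u)" by (rule sub)
    qed (auto simp: carr_u br_u br_closed br_self simp flip: es(8))
    show "linear_on (carr u) (invol u)"
      using linear_on_subset[OF invol_linear carr_u(2)] by (simp add: invol_u)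
    show "bilinear_on (P_part u) (form u)"
      using bilinear_on_subset[OF form_bilinear] by (auto simp: form_u P_u)
    show "span {br u x y |x y. x \<in> P_part u \<and> y \<in> P_part u} = K_part u" (is "span ?B = _")
    proof
      have "subspace (K_part u)"
        using subspace_inter[OF subspace_K sub] by (simp add: K_u carr_u Int_def K_carr cong: conj_cong)
      moreover have "?B \<subseteq> K_part u"
        by (auto simp: K_u P_u br_u br_PP P_carr simp flip: es(8))
      ultimately show "span ?B \<subseteq> K_part u" by (rule span_minimal[rotated])
      show "K_part u \<subseteq> span ?B"
      proof
        fix k assume k: "k \<in> K_part u"
        then have "k \<in> K_part t" by (simp add: K_u)
        then have "e k \<in> span ?B"
        proof (induction rule: K_induct)
          case (bracket x y)
          then have c: "x \<in> carr t" "y \<in> carr t" by (auto simp: P_carr)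
          have "e (br t x y) = e (e (br t x y))" using c idem by (simp add: br_closed)
          also have "\<dots> = br t (e x) (e y)" using c by (simp add: es)
          also have "\<dots> \<in> span ?B"
            using eP[OF bracket(1)] eP[OF bracket(2)] by (auto simp: br_u intro!: span_base)
          finally show ?case .
        qed (auto simp: es K_carr span_zero span_add span_scale)
        then show "k \<in> span ?B" using k by (simp add: K_u)
      qed
    qed
    show "k = 0" if k: "k \<in> K_part u" and "\<And>x. x \<in> P_part u \<Longrightarrow> br u k x = 0" for k
    proof (rule K_faithful)
      fix x assume x: "x \<in> P_part t"
      have "br t k x = br t k (e x)"
        using k x es(8)[of k x] by (simp add: K_u K_carr P_carr es)
      then show "br t k x = 0" using that(2)[OF eP[OF x]] by (simp add: br_u)
    qed (use k in \<open>simp add: K_u\<close>)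
    show "x = 0" if x: "x \<in> P_part u" and "\<And>y. y \<in> P_part u \<Longrightarrow> form u x y = 0" for x
    proof (rule form_nondegenerate)
      fix y assume y: "y \<in> P_part t"
      have "form t x y = form t x (e y)"
        using x y sa_centroid_form[OF e, of x y] by (simp add: P_u)
      then show "form t x y = 0" using that(2)[OF eP[OF y]] by (simp add: form_u)
    qed (use x in \<open>simp add: P_u\<close>)
  qed (auto simp: carr_u br_u invol_u form_u P_u K_u invol_closed invol_bracket invol_involutive
      form_alternating form_invariant es)
  show "stable_ideal_triple u t"
    unfolding stable_ideal_triple_def
    using sub by (auto simp: carr_u br_u invol_u form_u br_closed invol_closed es(7) simp flip: es(9))
qed

lemma sa_idempotent_trivial:
  assumes ind: "indecomposable t" and e: "e \<in> sa_centroid t"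
    and idem: "\<And>x. x \<in> carr t \<Longrightarrow> e (e x) = e x"
  shows "(\<forall>x\<in>carr t. e x = 0) \<or> (\<forall>x\<in>carr t. e x = x)"
proof (rule ccontr)
  assume neg: "\<not> ?thesis"
  note ec = sa_centroid_centroid[OF e]
  note es = centroid_simps[OF ec]
  define e' where "e' = (\<lambda>x. x - e x)"
  have e'_sa: "e' \<in> sa_centroid t"
    unfolding e'_def
  proof (rule sa_centroidI)
    show "(\<lambda>x. x - e x) \<in> centroid t" by (rule centroid_minus_fun[OF centroid_id ec])
    show "form t (x - e x) y = form t x (y - e y)" if "x \<in> P_part t" "y \<in> P_part t" for x y
      using that
      by (simp add: form_diff_left form_diff_right centroid_P[OF ec] sa_centroid_form[OF e])
  qed
  have e'_idem: "e' (e' x) = e' x" if "x \<in> carr t" for x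
    using that idem by (simp add: e'_def es)
  define s where "s = (\<lambda>i::nat. t\<lparr>carr := {x \<in> carr t. (if i = 1 then e else e') x = x}\<rparr>)"
  have s1: "s 1 = t\<lparr>carr := {x \<in> carr t. e x = x}\<rparr>"
      "s (Suc 0) = t\<lparr>carr := {x \<in> carr t. e x = x}\<rparr>"
    and s2: "s 2 = t\<lparr>carr := {x \<in> carr t. e' x = x}\<rparr>" by (simp_all add: s_def)
  have P1: "P_part (s 1) = {x \<in> P_part t. e x = x}"
    and P2: "P_part (s 2) = {x \<in> P_part t. e x = 0}"
    unfolding P_part_def s1 s2 by (auto simp: e'_def)
  have "direct_sum_of t {1, 2} s"
    unfolding direct_sum_of_def
  proof (intro conjI ballI impI)
    fix i assume "i \<in> {1, 2::nat}"
    then show "symplectic_symmetric_triple (s i)" "stable_ideal_triple (s i) t"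
      using sa_idempotent_image[OF e idem] sa_idempotent_image[OF e'_sa e'_idem] s1 s2 by auto
  next
    fix x assume x: "x \<in> carr t"
    let ?f = "\<lambda>i\<in>{1, 2::nat}. if i = 1 then e x else e' x"
    show "\<exists>!f. f \<in> (\<Pi>\<^sub>E i\<in>{1, 2}. carr (s i)) \<and> x = (\<Sum>i\<in>{1, 2}. f i)"
    proof (rule ex1I[of _ ?f])
      show "?f \<in> (\<Pi>\<^sub>E i\<in>{1, 2}. carr (s i)) \<and> x = (\<Sum>i\<in>{1, 2}. ?f i)"
        using x by (auto simp: s_def idem e'_idem es e'_def carr_intros)
    next
      fix f assume f: "f \<in> (\<Pi>\<^sub>E i\<in>{1, 2}. carr (s i)) \<and> x = (\<Sum>i\<in>{1, 2}. f i)"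
      then have "f 1 \<in> carr (s 1)" "f 2 \<in> carr (s 2)" by (auto simp: PiE_iff)
      then have f12: "f 1 \<in> carr t" "e (f 1) = f 1" "f 2 \<in> carr t" "e (f 2) = 0"
        by (auto simp: s1 s2 e'_def)
      have sum: "x = f 1 + f 2" using f by simp
      then have ex: "e x = f 1" using f12 by (simp add: es)
      show "f = ?f"
      proof (rule PiE_ext)
        show "f \<in> (\<Pi>\<^sub>E i\<in>{1, 2}. carr (s i))" using f by blast
        show "?f \<in> (\<Pi>\<^sub>E i\<in>{1, 2}. carr (s i))"
          using x by (auto simp: s_def idem e'_idem es e'_def carr_intros)
        show "f i = ?f i" if "i \<in> {1, 2}" for i
          using that ex sum by (auto simp: e'_def)
      qed
    qed
  next
    fix i j x y
    assume ij: "i \<in> {1, 2::nat}" "j \<in> {1, 2::nat}" "i \<noteq> j"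
      and xy: "x \<in> P_part (s i)" "y \<in> P_part (s j)"
    have "form t x y = 0" if "x \<in> P_part t" "y \<in> P_part t" "e x = x" "e y = 0" for x y
      using sa_centroid_form[OF e that(1,2)] that by (simp add: form_zero_right)
    moreover have "form t x y = 0" if "x \<in> P_part t" "y \<in> P_part t" "e x = 0" "e y = y" for x y
      using sa_centroid_form[OF e that(1,2)] that by (simp add: form_zero_left)
    ultimately show "form t x y = 0" using ij xy P1 P2 by auto
  qed simp
  moreover have "carr (s 1) \<noteq> {0}"
  proof
    assume "carr (s 1) = {0}"
    then have "\<forall>x\<in>carr t. e x = 0" using idem es(1) by (auto simp: s1)
    with neg show False by blast
  qed
  moreover have "carr (s 2) \<noteq> {0}"
  proof
    assume a: "carr (s 2) = {0}"
    have "e x = x" if x: "x \<in> carr t" for x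
    proof -
      have "e' x \<in> carr (s 2)" using x e'_idem by (simp add: s2) (simp add: e'_def es carr_intros)
      then show ?thesis using a by (simp add: e'_def)
    qed
    with neg show False by blast
  qed
  ultimately show False using ind by (auto simp: indecomposable_def decomposable_def)
qed

text \<open>
  Two central vectors that are not orthogonal span a symplectic plane, and the orthogonal
  projection \<open>e\<close> onto this plane, extended by zero to \<open>K\<close>, belongs to the centroid: both
  \<open>[e x, y]\<close> and \<open>e [x, y]\<close> vanish, the latter because invariance of the form makes \<open>[K, P]\<close>
  orthogonal to every central vector. So \<open>e\<close> is the identity, which forces \<open>K = 0\<close>.
\<close>

lemma central_part_isotropic:
  assumes ind: "indecomposable t" and nf: "\<not> flat t"
    and z: "z \<in> central_part t" and w: "w \<in> central_part t"
  shows "form t z w = 0"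
proof (rule ccontr)
  assume "form t z w \<noteq> 0"
  define z' where "z' = (1 / form t z w) *\<^sub>R z"
  have zP: "z' \<in> P_part t" "w \<in> P_part t" and zc: "\<And>y. y \<in> carr t \<Longrightarrow> br t z' y = 0"
    and wc: "\<And>y. y \<in> carr t \<Longrightarrow> br t w y = 0"
    using z w by (auto simp: central_part_def z'_def P_intros P_carr
        linear_on_scale[OF br_linear_left])
  have zw: "form t z' w = 1" "form t w z' = - 1" "form t z' z' = 0" "form t w w = 0"
    using \<open>form t z w \<noteq> 0\<close> zP z w form_skew[of w z']
    by (auto simp: z'_def form_scale_left central_part_def form_alternating)
  \<comment> \<open>\<open>P\<close> is the projection onto the \<open>-1\<close> eigenspace; the form is meaningful only there.\<close>
  define P where "P = (\<lambda>x. (1/2) *\<^sub>R (x - invol t x))"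
  have PP: "P x \<in> P_part t" if "x \<in> carr t" for x
    using that by (simp add: P_def P_part_def carr_intros invol_diff invol_scale invol_involutive
        flip: scaleR_minus_right)
  have P_id: "P x = x" if "x \<in> P_part t" for x
    using that by (simp add: P_def P_part_def flip: scaleR_2)
  have P_K: "P x = 0" if "x \<in> K_part t" for x
    using that by (simp add: P_def K_part_def)
  have P_add: "P (x + y) = P x + P y" and P_scale: "P (c *\<^sub>R x) = c *\<^sub>R P x"
    and P_invol: "P (invol t x) = - P x" if "x \<in> carr t" "y \<in> carr t" for x y c
    using that by (auto simp: P_def invol_add invol_scale invol_involutive algebra_simps)
  define e where "e = (\<lambda>x. form t (P x) w *\<^sub>R z' - form t (P x) z' *\<^sub>R w)"
  have orth: "form t (P (br t x y)) v = 0"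
    if xy: "x \<in> carr t" "y \<in> carr t" and v: "v \<in> P_part t" "\<And>y. y \<in> carr t \<Longrightarrow> br t v y = 0"
    for x y v
  proof -
    obtain k a where x: "k \<in> K_part t" "a \<in> P_part t" "x = k + a" using K_plus_P[OF xy(1)] .
    obtain l b where y: "l \<in> K_part t" "b \<in> P_part t" "y = l + b" using K_plus_P[OF xy(2)] .
    have c: "k \<in> carr t" "a \<in> carr t" "l \<in> carr t" "b \<in> carr t"
      using x y by (auto simp: K_carr P_carr)
    have inv0: "form t (br t m d) v = 0" if "m \<in> K_part t" "d \<in> P_part t" for m d
      using form_invariant[OF that v(1)] br_skew[of m v] v that
      by (simp add: K_carr P_carr form_zero_right)
    have KK: "br t k l \<in> K_part t"
      using x y by (auto simp: K_part_def br_closed invol_bracket)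
    have aP: "br t a l \<in> P_part t" and a0: "form t (br t a l) v = 0"
      using inv0[OF y(1) x(2)] br_KP[OF y(1) x(2)] br_skew[of a l] c v(1)
        form_diff_left[OF v(1) P_intros(1), of "br t l a"] 
      by (auto simp: P_intros form_zero_left)
    have "P (br t x y) = br t k b + br t a l"
      using x y c by (simp add: br_add_left br_add_right carr_intros P_add P_K[OF KK]
          P_K[OF br_PP] P_id[OF br_KP] P_id[OF aP])
    then show ?thesis using inv0[OF x(1) y(2)] a0 aP br_KP[OF x(1) y(2)] v(1)
      by (simp add: form_add_left)
  qed
  have e_PP: "e x \<in> P_part t" if "x \<in> carr t" for x
    using zP by (simp add: e_def P_intros)
  have "e \<in> centroid t"
  proof (rule centroidI)
    show "e x \<in> carr t" if "x \<in> carr t" for x using P_carr[OF e_PP[OF that]] .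
    show "linear_on (carr t) e"
      unfolding linear_on_def using zP
      by (auto simp: e_def P_add P_scale PP form_add_left form_scale_left algebra_simps)
    show "e (invol t x) = invol t (e x)" if x: "x \<in> carr t" for x
    proof -
      have "form t (- P x) v = - form t (P x) v" if "v \<in> P_part t" for v
        using linear_on_minus[OF form_linear_left[OF that] PP[OF x]] .
      then have "e (invol t x) = - e x"
        using zP x by (simp add: e_def P_invol)
      then show ?thesis using e_PP[OF x] by (simp add: P_part_def)
    qed
    show "e (br t x y) = br t (e x) y" if xy: "x \<in> carr t" "y \<in> carr t" for x y
    proof -
      have "e (br t x y) = 0"
        using orth[OF xy zP(1) zc] orth[OF xy zP(2) wc] by (simp add: e_def)
      moreover have "br t (e x) y = 0"
        using zP xy zc wc linear_on_diff[OF br_linear_left[OF xy(2)] subspace_carr]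
        by (simp add: e_def P_carr carr_intros linear_on_scale[OF br_linear_left])
      ultimately show ?thesis by simp
    qed
  qed
  then have e_sa: "e \<in> sa_centroid t"
  proof (rule sa_centroidI)
    fix x y assume xy: "x \<in> P_part t" "y \<in> P_part t"
    then show "form t (e x) y = form t x (e y)"
      using zP form_skew[of z' y] form_skew[of w y]
      by (simp add: e_def P_id form_diff_left form_diff_right form_scale_left form_scale_right
          P_intros)
  qed
  have idem: "e (e x) = e x" if x: "x \<in> carr t" for x
  proof -
    have "form t (e x) w = form t (P x) w" "form t (e x) z' = form t (P x) z'"
      using zP zw by (auto simp: e_def form_diff_left form_scale_left P_intros)
    then show ?thesis using P_id[OF e_PP[OF x]] by (simp add: e_def)
  qed
  have "e z' = z'" using zw zP by (simp add: e_def P_id)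
  moreover have "z' \<noteq> 0" using zw(1) form_zero_left[OF zP(2)] by force
  ultimately have id: "\<forall>x\<in>carr t. e x = x"
    using sa_idempotent_trivial[OF ind e_sa idem] P_carr[OF zP(1)] by metis
  have "k = 0" if "k \<in> K_part t" for k
    using id[rule_format, OF K_carr[OF that]] zP
    by (simp add: e_def P_K[OF that] form_zero_left)
  then show False using nf subspace_0[OF subspace_K] by (auto simp: flat_def)
qed

lemma square_zero_of_isotropic_range:
  assumes ind: "\<And>x y. x \<in> P_part t \<Longrightarrow> y \<in> P_part t \<Longrightarrow> form t (n x) (n y) = 0"
    and n: "n \<in> sa_centroid t" and x: "x \<in> P_part t"
  shows "n (n x) = 0"
proof (rule form_nondegenerate)
  note nc = sa_centroid_centroid[OF n]
  show nnP: "n (n x) \<in> P_part t" using x by (simp add: centroid_P[OF nc])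
  show "form t (n (n x)) y = 0" if y: "y \<in> P_part t" for y
    using ind[OF x y] sa_centroid_form[OF n centroid_P[OF nc x] y] by simp
qed

text \<open>
  Lifting of idempotents: \<open>n = c\<^sup>2 - c\<close> vanishes on \<open>K\<close>, so its values on \<open>P\<close> are central, hence
  mutually orthogonal, and \<open>n\<^sup>2 = 0\<close>. Then \<open>e = 3 c\<^sup>2 - 2 c\<^sup>3\<close> is idempotent, as \<open>e\<^sup>2 - e\<close> is a multiple of
  \<open>(c\<^sup>2 - c)\<^sup>2\<close>, and it agrees with \<open>c\<close> on \<open>K\<close>.
\<close>

lemma idempotent_on_K_trivial:
  assumes ind: "indecomposable t" and nf: "\<not> flat t" and c: "c \<in> sa_centroid t"
    and idem: "\<And>k. k \<in> K_part t \<Longrightarrow> c (c k) = c k"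
  shows "(\<forall>k\<in>K_part t. c k = 0) \<or> (\<forall>k\<in>K_part t. c k = k)"
proof -
  note cc = sa_centroid_centroid[OF c]
  note cs = centroid_simps[OF cc]
  define n where "n = (\<lambda>x. c (c x) - c x)"
  have nc: "n \<in> centroid t"
    unfolding n_def by (rule centroid_minus_fun[OF centroid_comp[OF cc cc] cc])
  have n_sa: "n \<in> sa_centroid t"
  proof (rule sa_centroidI[OF nc])
    show "form t (n x) y = form t x (n y)" if "x \<in> P_part t" "y \<in> P_part t" for x y
      using that
      by (simp add: n_def form_diff_left form_diff_right centroid_P[OF cc] sa_centroid_form[OF c])
  qed
  have nK: "n k = 0" if "k \<in> K_part t" for k using idem[OF that] by (simp add: n_def)
  have n_central: "n x \<in> central_part t" if "x \<in> P_part t" for x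
    using centroid_zero_on_K_imp_central[OF nc nK that] .
  have nnP: "n (n x) = 0" if "x \<in> P_part t" for x
    using square_zero_of_isotropic_range[OF _ n_sa that] n_central
      central_part_isotropic[OF ind nf] by blast
  have nn: "n (n x) = 0" if x: "x \<in> carr t" for x
  proof -
    obtain k v where kv: "k \<in> K_part t" "v \<in> P_part t" "x = k + v" using K_plus_P[OF x] .
    then show ?thesis
      using nK nnP by (simp add: centroid_simps[OF nc] K_carr P_carr)
  qed
  have c4: "c (c (c (c x))) = 2 *\<^sub>R c (c (c x)) - c (c x)" if x: "x \<in> carr t" for x
    using nn[OF x] x by (simp add: n_def cs carr_intros scaleR_2 algebra_simps)
  define e where "e = (\<lambda>x. 3 *\<^sub>R c (c x) - 2 *\<^sub>R c (c (c x)))"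
  have e_sa: "e \<in> sa_centroid t"
  proof (rule sa_centroidI)
    show "e \<in> centroid t"
      unfolding e_def
      by (rule centroid_minus_fun[OF centroid_scaleR[OF centroid_comp[OF cc cc]]
            centroid_scaleR[OF centroid_comp[OF cc centroid_comp[OF cc cc]]]])
    show "form t (e x) y = form t x (e y)" if "x \<in> P_part t" "y \<in> P_part t" for x y
      using that by (simp add: e_def form_diff_left form_diff_right form_scale_left
          form_scale_right centroid_P[OF cc] P_intros sa_centroid_form[OF c])
  qed
  have e_idem: "e (e x) = e x" if x: "x \<in> carr t" for x
    using x scaleR_add_left[of 2 6 "c (c (c x))"] scaleR_add_left[of 3 9 "c (c x)"]
    by (simp add: e_def cs carr_intros c4 algebra_simps)
  have eK: "e k = c k" if "k \<in> K_part t" for k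
    using idem[OF that] by (simp add: e_def flip: scaleR_diff_left)
  show ?thesis
    using sa_idempotent_trivial[OF ind e_sa e_idem] eK K_carr by metis
qed

end

section \<open>Projections onto the summands of a direct sum\<close>

definition component :: "'i set \<Rightarrow> ('i \<Rightarrow> 'a::real_vector triple) \<Rightarrow> 'i \<Rightarrow> 'a \<Rightarrow> 'a" where
  "component I s i x = (THE f. f \<in> (\<Pi>\<^sub>E j\<in>I. carr (s j)) \<and> x = (\<Sum>j\<in>I. f j)) i"

locale triple_sum = symplectic_symmetric_triple t
  for t :: "'a::real_vector triple" +
  fixes I :: "'i set" and s :: "'i \<Rightarrow> 'a triple"
  assumes direct_sum: "direct_sum_of t I s"
begin

lemma finite_index: "finite I"
  and summand_triple: "i \<in> I \<Longrightarrow> symplectic_symmetric_triple (s i)"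
  and summand_stable: "i \<in> I \<Longrightarrow> stable_ideal_triple (s i) t"
  and ex1_decomposition:
    "x \<in> carr t \<Longrightarrow> \<exists>!f. f \<in> (\<Pi>\<^sub>E j\<in>I. carr (s j)) \<and> x = (\<Sum>j\<in>I. f j)"
  and summands_orthogonal:
    "i \<in> I \<Longrightarrow> j \<in> I \<Longrightarrow> i \<noteq> j \<Longrightarrow> x \<in> P_part (s i) \<Longrightarrow> y \<in> P_part (s j) \<Longrightarrow> form t x y = 0"
  using direct_sum by (auto simp: direct_sum_of_def)

lemma summand_subspace: "i \<in> I \<Longrightarrow> subspace (carr (s i))"
  and summand_carr: "i \<in> I \<Longrightarrow> x \<in> carr (s i) \<Longrightarrow> x \<in> carr t"
  and summand_ideal: "i \<in> I \<Longrightarrow> x \<in> carr t \<Longrightarrow> y \<in> carr (s i) \<Longrightarrow> br t x y \<in> carr (s i)"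
  and summand_invol_closed: "i \<in> I \<Longrightarrow> x \<in> carr (s i) \<Longrightarrow> invol t x \<in> carr (s i)"
  and summand_br: "i \<in> I \<Longrightarrow> x \<in> carr (s i) \<Longrightarrow> y \<in> carr (s i) \<Longrightarrow> br (s i) x y = br t x y"
  and summand_invol: "i \<in> I \<Longrightarrow> x \<in> carr (s i) \<Longrightarrow> invol (s i) x = invol t x"
  and summand_form:
    "i \<in> I \<Longrightarrow> x \<in> P_part (s i) \<Longrightarrow> y \<in> P_part (s i) \<Longrightarrow> form (s i) x y = form t x y"
  using summand_stable[of i] by (auto simp: stable_ideal_triple_def)

lemma summand_P: "i \<in> I \<Longrightarrow> P_part (s i) = P_part t \<inter> carr (s i)"
  and summand_K: "i \<in> I \<Longrightarrow> K_part (s i) = K_part t \<inter> carr (s i)"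
  by (auto simp: P_part_def K_part_def summand_carr summand_invol)

lemma component_the:
  assumes "x \<in> carr t"
  defines "f \<equiv> THE f. f \<in> (\<Pi>\<^sub>E j\<in>I. carr (s j)) \<and> x = (\<Sum>j\<in>I. f j)"
  shows "f \<in> (\<Pi>\<^sub>E j\<in>I. carr (s j)) \<and> x = (\<Sum>j\<in>I. f j)"
  unfolding f_def by (rule theI'[OF ex1_decomposition[OF assms(1)]])

lemma component_in: "i \<in> I \<Longrightarrow> x \<in> carr t \<Longrightarrow> component I s i x \<in> carr (s i)"
  and component_sum: "x \<in> carr t \<Longrightarrow> (\<Sum>i\<in>I. component I s i x) = x"
  using component_the[of x] by (auto simp: component_def PiE_iff)

lemma component_unique:
  assumes f: "\<And>j. j \<in> I \<Longrightarrow> f j \<in> carr (s j)" and x: "x = (\<Sum>j\<in>I. f j)" and i: "i \<in> I"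
  shows "component I s i x = f i"
proof -
  have xc: "x \<in> carr t" unfolding x by (rule carr_intros) (use f summand_carr in auto)
  have "restrict f I \<in> (\<Pi>\<^sub>E j\<in>I. carr (s j)) \<and> x = (\<Sum>j\<in>I. restrict f I j)"
    using f x by auto
  then have "(THE f. f \<in> (\<Pi>\<^sub>E j\<in>I. carr (s j)) \<and> x = (\<Sum>j\<in>I. f j)) = restrict f I"
    using component_the[OF xc] ex1_decomposition[OF xc] by blast
  then show ?thesis using i by (simp add: component_def)
qed

lemma component_of_summand:
  assumes "i \<in> I" "j \<in> I" "x \<in> carr (s j)"
  shows "component I s i x = (if i = j then x else 0)"
proof (rule component_unique[OF _ _ assms(1)])
  show "(if k = j then x else 0) \<in> carr (s k)" if "k \<in> I" for k
    using that assms subspace_0[OF summand_subspace] by auto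
  show "x = (\<Sum>k\<in>I. if k = j then x else 0)"
    using assms finite_index by simp
qed

lemma component_component:
  assumes "i \<in> I" "j \<in> I" "x \<in> carr t"
  shows "component I s i (component I s j x) = (if i = j then component I s j x else 0)"
  using component_of_summand[OF assms(1,2) component_in[OF assms(2,3)]] .

text \<open>
  Each property follows from uniqueness of the decomposition, because the summands are stable
  under the linear operations, the involution and brackets with arbitrary elements.
\<close>

lemma component_centroid:
  assumes i: "i \<in> I"
  shows "component I s i \<in> centroid t"
proof (rule centroidI)
  show "component I s i x \<in> carr t" if "x \<in> carr t" for x
    using component_in[OF i that] summand_carr[OF i] by blast
  show "linear_on (carr t) (component I s i)"
    unfolding linear_on_def
  proof (intro conjI ballI allI)
    fix x y c assume xy: "x \<in> carr t"
    show "component I s i (c *\<^sub>R x) = c *\<^sub>R component I s i x"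
    proof (rule component_unique[OF _ _ i])
      show "c *\<^sub>R component I s j x \<in> carr (s j)" if "j \<in> I" for j
        using component_in[OF that xy] subspace_scale[OF summand_subspace[OF that]] by blast
      show "c *\<^sub>R x = (\<Sum>j\<in>I. c *\<^sub>R component I s j x)"
        using component_sum[OF xy] by (simp flip: scaleR_sum_right)
    qed
    assume y: "y \<in> carr t"
    show "component I s i (x + y) = component I s i x + component I s i y"
    proof (rule component_unique[OF _ _ i])
      show "component I s j x + component I s j y \<in> carr (s j)" if "j \<in> I" for j
        using component_in[OF that xy] component_in[OF that y]
          subspace_add[OF summand_subspace[OF that]] by blast
      show "x + y = (\<Sum>j\<in>I. component I s j x + component I s j y)"
        using component_sum[OF xy] component_sum[OF y] by (simp add: sum.distrib)
    qed
  qed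
  fix x assume x: "x \<in> carr t"
  have xj: "component I s j x \<in> carr t" if "j \<in> I" for j
    using component_in[OF that x] summand_carr[OF that] by blast
  show "component I s i (invol t x) = invol t (component I s i x)"
  proof (rule component_unique[OF _ _ i])
    show "invol t (component I s j x) \<in> carr (s j)" if "j \<in> I" for j
      using component_in[OF that x] summand_invol_closed[OF that] by blast
    show "invol t x = (\<Sum>j\<in>I. invol t (component I s j x))"
      using linear_on_sum[OF invol_linear subspace_carr, of I "\<lambda>j. component I s j x"] xj
        component_sum[OF x] by simp
  qed
  fix y assume y: "y \<in> carr t"
  show "component I s i (br t x y) = br t (component I s i x) y"
  proof (rule component_unique[OF _ _ i])
    show "br t (component I s j x) y \<in> carr (s j)" if j: "j \<in> I" for j
      using br_skew[OF xj[OF j] y] subspace_neg[OF summand_subspace[OF j]]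
        summand_ideal[OF j y component_in[OF j x]] by simp
    show "br t x y = (\<Sum>j\<in>I. br t (component I s j x) y)"
      using linear_on_sum[OF br_linear_left[OF y] subspace_carr, of I "\<lambda>j. component I s j x"] xj
        component_sum[OF x] by simp
  qed
qed

lemma component_P: "i \<in> I \<Longrightarrow> x \<in> P_part t \<Longrightarrow> component I s i x \<in> P_part (s i)"
  and component_P_t: "i \<in> I \<Longrightarrow> x \<in> P_part t \<Longrightarrow> component I s i x \<in> P_part t"
  and component_K: "i \<in> I \<Longrightarrow> k \<in> K_part t \<Longrightarrow> component I s i k \<in> K_part (s i)"
  and component_carr: "i \<in> I \<Longrightarrow> x \<in> carr t \<Longrightarrow> component I s i x \<in> carr t"
  using centroid_P[OF component_centroid] centroid_K[OF component_centroid]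
    centroid_closed[OF component_centroid]
  by (auto simp: summand_P summand_K component_in P_carr K_carr)

lemma form_component:
  assumes i: "i \<in> I" and xy: "x \<in> P_part t" "y \<in> P_part t"
  shows "form t (component I s i x) y = form t (component I s i x) (component I s i y)"
    "form t x (component I s i y) = form t (component I s i x) (component I s i y)"
proof -
  let ?p = "component I s"
  have "form t (?p i x) (\<Sum>j\<in>I. ?p j y) = (\<Sum>j\<in>I. form t (?p i x) (?p j y))"
    using xy i by (intro form_sum_right) (auto simp: component_P_t)
  also have "\<dots> = (\<Sum>j\<in>I. if j = i then form t (?p i x) (?p i y) else 0)"
    using summands_orthogonal[OF i] xy i by (intro sum.cong) (auto simp: component_P)
  finally show "form t (?p i x) y = form t (?p i x) (?p i y)"
    using i finite_index component_sum xy by (simp add: P_carr)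
  have "form t (\<Sum>j\<in>I. ?p j x) (?p i y) = (\<Sum>j\<in>I. form t (?p j x) (?p i y))"
    using xy i by (intro form_sum_left) (auto simp: component_P_t)
  also have "\<dots> = (\<Sum>j\<in>I. if j = i then form t (?p i x) (?p i y) else 0)"
    using summands_orthogonal[OF _ i] xy i by (intro sum.cong) (auto simp: component_P)
  finally show "form t x (?p i y) = form t (?p i x) (?p i y)"
    using i finite_index component_sum xy by (simp add: P_carr)
qed

lemma component_sa: "i \<in> I \<Longrightarrow> component I s i \<in> sa_centroid t"
  by (rule sa_centroidI[OF component_centroid]) (auto simp: form_component)

lemma form_eq_sum_components:
  assumes "x \<in> P_part t" "y \<in> P_part t"
  shows "form t x y = (\<Sum>i\<in>I. form t (component I s i x) (component I s i y))"
proof -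
  have "form t (\<Sum>i\<in>I. component I s i x) y = (\<Sum>i\<in>I. form t (component I s i x) y)"
    using assms by (intro form_sum_left) (auto simp: component_P_t)
  then show ?thesis using assms component_sum[OF P_carr] form_component by simp
qed

lemma centroid_summand:
  assumes i: "i \<in> I" and f: "f \<in> centroid t" and maps: "\<And>x. x \<in> carr (s i) \<Longrightarrow> f x \<in> carr (s i)"
  shows "f \<in> centroid (s i)"
proof (rule symplectic_symmetric_triple.centroidI[OF summand_triple[OF i]])
  note c = summand_carr[OF i]
  show "linear_on (carr (s i)) f"
    using linear_on_subset[OF centroid_linear[OF f]] c by blast
  show "f (invol (s i) x) = invol (s i) (f x)" if "x \<in> carr (s i)" for x
    using that maps by (simp add: summand_invol[OF i] c centroid_invol[OF f])
  show "f (br (s i) x y) = br (s i) (f x) y" if "x \<in> carr (s i)" "y \<in> carr (s i)" for x y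
    using that maps by (simp add: summand_br[OF i] c centroid_br_left[OF f])
qed (fact maps)

lemma component_central_part:
  assumes i: "i \<in> I" and z: "z \<in> central_part t"
  shows "component I s i z \<in> central_part (s i)"
  using central_part_centroid[OF component_centroid[OF i] z] component_in[OF i] z
  by (auto simp: central_part_def summand_P[OF i] P_carr summand_br[OF i] summand_carr[OF i])

text \<open>
  The components of a central vector are central in their summands, and all summands except
  \<open>i\<^sub>0\<close> have isotropic centre; so only the \<open>i\<^sub>0\<close> component contributes to the form.
\<close>

lemma form_on_central_part:
  assumes i0: "i\<^sub>0 \<in> I"
    and ind: "\<And>i. i \<in> I \<Longrightarrow> i \<noteq> i\<^sub>0 \<Longrightarrow> indecomposable (s i) \<and> \<not> flat (s i)"
    and z: "z \<in> central_part t" and w: "w \<in> central_part t"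
  shows "form t (component I s i\<^sub>0 z) (component I s i\<^sub>0 w) = form t z w"
proof -
  let ?p = "component I s"
  have P: "z \<in> P_part t" "w \<in> P_part t" using z w by (auto simp: central_part_def)
  have "form t (?p i z) (?p i w) = 0" if i: "i \<in> I" "i \<noteq> i\<^sub>0" for i
    using symplectic_symmetric_triple.central_part_isotropic[OF summand_triple[OF i(1)]]
      ind[OF i] component_central_part[OF i(1)] z w component_P[OF i(1)] P
      summand_form[OF i(1)] by metis
  then have "form t z w = (\<Sum>i\<in>I. if i = i\<^sub>0 then form t (?p i\<^sub>0 z) (?p i\<^sub>0 w) else 0)"
    unfolding form_eq_sum_components[OF P] by (intro sum.cong) auto
  then show ?thesis using i0 finite_index by simp
qed

lemma K_part_included_imp_flat:
  assumes "i \<in> I" "j \<in> I" "i \<noteq> j" "K_part (s i) \<subseteq> K_part (s j)"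
  shows "flat (s i)"
proof -
  have "k = 0" if k: "k \<in> K_part (s i)" for k
  proof -
    have "k \<in> carr (s i)" "k \<in> carr (s j)" using k assms summand_K by auto
    then show ?thesis
      using component_of_summand[of i i k] component_of_summand[of i j k] assms by simp
  qed
  moreover have "0 \<in> K_part (s i)"
    using assms(1) subspace_0[OF subspace_K] subspace_0[OF summand_subspace] summand_K by simp
  ultimately show ?thesis by (auto simp: flat_def)
qed

text \<open>
  The projection onto a flat summand vanishes on \<open>K\<close>.
\<close>

lemma flat_summand_central:
  assumes i: "i \<in> I" and flat: "flat (s i)" and x: "x \<in> P_part t"
  shows "component I s i x \<in> central_part t"
  by (rule centroid_zero_on_K_imp_central[OF component_centroid[OF i] _ x])
    (use component_K[OF i] flat in \<open>auto simp: flat_def\<close>)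

end

section \<open>Comparing two decompositions\<close>

locale two_triple_sums = A: triple_sum t I s + B: triple_sum t J s'
  for t :: "'a::real_vector triple" and I :: "'i set" and s and J :: "'j set" and s'
begin

text \<open>
  The two projections commute on \<open>K\<close>, so their product is idempotent there; compressed to the
  indecomposable summand \<open>s i\<close>, it is self-adjoint, and lifting of idempotents applies.
\<close>

lemma B_component_on_K_trivial:
  assumes i: "i \<in> I" and j: "j \<in> J" and ind: "indecomposable (s i)" "\<not> flat (s i)"
  shows "(\<forall>k\<in>K_part (s i). component J s' j k = 0) \<or>
    (\<forall>k\<in>K_part (s i). component J s' j k = k)"
proof -
  let ?a = "component I s i" and ?b = "component J s' j"
  note ac = A.component_centroid[OF i] and bc = B.component_centroid[OF j]
  interpret S: symplectic_symmetric_triple "s i" using A.summand_triple[OF i] .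
  define c where "c = (\<lambda>x. ?a (?b x))"
  have a_id: "?a x = x" if "x \<in> carr (s i)" for x
    using A.component_of_summand[OF i i that] by simp
  have c_centroid: "c \<in> centroid (s i)"
    unfolding c_def
  proof (rule A.centroid_summand[OF i A.centroid_comp[OF ac bc]])
    show "?a (?b x) \<in> carr (s i)" if "x \<in> carr (s i)" for x
      using that A.summand_carr[OF i] B.component_carr[OF j] A.component_in[OF i] by blast
  qed
  have c_sa: "c \<in> sa_centroid (s i)"
  proof (rule S.sa_centroidI[OF c_centroid])
    fix x y assume xy: "x \<in> P_part (s i)" "y \<in> P_part (s i)"
    then have P: "x \<in> P_part t" "y \<in> P_part t" and id: "?a x = x" "?a y = y"
      using A.summand_P[OF i] a_id by auto
    have "form t (c x) y = form t (?b x) y"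
      unfolding c_def
      using sa_centroid_form[OF A.component_sa[OF i] B.component_P_t[OF j P(1)] P(2)] id by simp
    also have "\<dots> = form t x (?b y)"
      using sa_centroid_form[OF B.component_sa[OF j] P] .
    also have "\<dots> = form t x (c y)"
      unfolding c_def
      using sa_centroid_form[OF A.component_sa[OF i] P(1) B.component_P_t[OF j P(2)]] id by simp
    finally show "form (s i) (c x) y = form (s i) x (c y)"
      using xy S.centroid_P[OF c_centroid] by (simp add: A.summand_form[OF i])
  qed
  have c_K: "c k = ?b k" if k: "k \<in> K_part (s i)" for k
    using k A.centroid_commute_on_K[OF ac bc, of k] a_id[of k] A.summand_K[OF i] by (simp add: c_def)
  have "c (c k) = c k" if k: "k \<in> K_part (s i)" for k
    using c_K[OF k] c_K[OF S.centroid_K[OF c_centroid k]] k A.summand_K[OF i]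
      B.component_component[OF j j, of k] A.K_carr by auto
  then have "(\<forall>k\<in>K_part (s i). c k = 0) \<or> (\<forall>k\<in>K_part (s i). c k = k)"
    by (rule S.idempotent_on_K_trivial[OF ind c_sa])
  then show ?thesis using c_K by simp
qed

text \<open>
  The components of a vector \<open>k \<noteq> 0\<close> in the \<open>K\<close>-part of \<open>s i\<close> add up to \<open>k\<close>, so some projection of the
  second decomposition is non-zero, hence the identity, on this \<open>K\<close>-part.
\<close>

lemma K_part_in_one_summand:
  assumes i: "i \<in> I" and ind: "indecomposable (s i)" "\<not> flat (s i)"
  shows "\<exists>j\<in>J. \<not> flat (s' j) \<and> K_part (s i) \<subseteq> K_part (s' j)"
proof -
  interpret S: symplectic_symmetric_triple "s i" using A.summand_triple[OF i] .
  obtain k where k: "k \<in> K_part (s i)" "k \<noteq> 0"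
    using ind(2) subspace_0[OF S.subspace_K] by (auto simp: flat_def)
  have kt: "k \<in> K_part t" using k A.summand_K[OF i] by blast
  have "\<exists>j\<in>J. component J s' j k \<noteq> 0"
    using B.component_sum[OF A.K_carr[OF kt]] k(2) sum.neutral by metis
  then obtain j where j: "j \<in> J" "component J s' j k \<noteq> 0" by blast
  then have id: "component J s' j l = l" if "l \<in> K_part (s i)" for l
    using B_component_on_K_trivial[OF i j(1) ind] k(1) that by blast
  have "K_part (s i) \<subseteq> K_part (s' j)"
  proof
    fix l assume l: "l \<in> K_part (s i)"
    then have "component J s' j l \<in> K_part (s' j)"
      using A.summand_K[OF i] B.component_K[OF j(1)] by blast
    then show "l \<in> K_part (s' j)" using id[OF l] by simp
  qed
  then show ?thesis using j(1) k by (auto simp: flat_def)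
qed

text \<open>
  The correction \<open>\<phi> = \<psi> (1 - n/2)\<close> of \<open>\<psi> = \<Sum>\<^sub>j \<pi>'\<^sub>j \<pi>\<^sub>\<theta>\<^sub>j\<close> by the inverse square root of \<open>c = \<psi>\<^sup>* \<psi> = 1 + n\<close>. The
  maps \<open>\<phi>\<close> and \<open>\<psi>\<close> intertwine \<open>\<pi>\<^sub>\<theta>\<^sub>j\<close> with \<open>\<pi>'\<^sub>j\<close>, which is why the surjectivity of \<open>\<phi>\<close> on \<open>t\<close> gives its
  surjectivity from each summand to the corresponding one.
\<close>

lemma isomorphic_decompositions:
  assumes \<theta>: "bij_betw \<theta> J I" and K_eq: "\<And>j. j \<in> J \<Longrightarrow> K_part (s (\<theta> j)) = K_part (s' j)"
    and j0: "j\<^sub>0 \<in> J" "flat (s (\<theta> j\<^sub>0))"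
    and ind: "\<And>i. i \<in> I \<Longrightarrow> i \<noteq> \<theta> j\<^sub>0 \<Longrightarrow> indecomposable (s i) \<and> \<not> flat (s i)"
    and ind': "\<And>j. j \<in> J \<Longrightarrow> j \<noteq> j\<^sub>0 \<Longrightarrow> indecomposable (s' j) \<and> \<not> flat (s' j)"
  shows "\<exists>\<phi>. triple_automorphism \<phi> t \<and> (\<forall>j\<in>J. triple_iso \<phi> (s (\<theta> j)) (s' j))"
proof -
  let ?a = "\<lambda>j. component I s (\<theta> j)" and ?b = "component J s'"
  have \<theta>I: "\<theta> j \<in> I" if "j \<in> J" for j using \<theta> that by (auto simp: bij_betw_def)
  have \<theta>_inj: "\<theta> j = \<theta> j' \<longleftrightarrow> j = j'" if "j \<in> J" "j' \<in> J" for j j'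
    using \<theta> that by (auto simp: bij_betw_def inj_on_def)
  have ac: "?a j \<in> centroid t" and bc: "?b j \<in> centroid t" if "j \<in> J" for j
    using A.component_centroid[OF \<theta>I] B.component_centroid that by auto
  have a_sum: "(\<Sum>j\<in>J. ?a j x) = x" if "x \<in> carr t" for x
    using sum.reindex_bij_betw[OF \<theta>, of "\<lambda>i. component I s i x"] A.component_sum[OF that] by simp
  have aa: "?a j (?a j' x) = (if j = j' then ?a j x else 0)" if "j \<in> J" "j' \<in> J" "x \<in> carr t" for j j' x
    using A.component_component[OF \<theta>I \<theta>I, of j j' x] that \<theta>_inj by auto

  define \<psi> where "\<psi> = (\<lambda>x. \<Sum>j\<in>J. ?b j (?a j x))"
  define c where "c = (\<lambda>x. \<Sum>j\<in>J. ?a j (?b j (?a j x)))"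
  define n where "n = (\<lambda>x. c x - x)"
  define \<phi> where "\<phi> = (\<lambda>x. \<psi> (x - (1/2) *\<^sub>R n x))"
  have \<psi>c: "\<psi> \<in> centroid t"
    unfolding \<psi>_def by (rule A.centroid_sum) (use A.centroid_comp ac bc in blast)
  have cc: "c \<in> centroid t"
    unfolding c_def
    by (rule A.centroid_sum) (use A.centroid_comp[OF ac A.centroid_comp[OF bc ac]] in blast)
  have nc: "n \<in> centroid t"
    unfolding n_def by (rule A.centroid_minus_fun[OF cc A.centroid_id])
  have \<phi>c: "\<phi> \<in> centroid t"
    unfolding \<phi>_def
    by (rule A.centroid_comp[OF \<psi>c A.centroid_minus_fun[OF A.centroid_id A.centroid_scaleR[OF nc]]])

  have b_a_K: "?b j (?a j k) = ?a j k" if j: "j \<in> J" and k: "k \<in> K_part t" for j k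
  proof -
    have "?a j k \<in> carr (s' j)"
      using A.component_K[OF \<theta>I[OF j] k] K_eq[OF j] B.summand_K[OF j] by auto
    then show ?thesis using B.component_of_summand[OF j j] by simp
  qed
  have \<psi>K: "\<psi> k = k" if "k \<in> K_part t" for k
    using that b_a_K a_sum by (simp add: \<psi>_def A.K_carr)
  have nK: "n k = 0" if "k \<in> K_part t" for k
    using that b_a_K a_sum aa by (simp add: n_def c_def A.K_carr)
  have \<phi>K: "\<phi> k = k" if "k \<in> K_part t" for k
    using that nK \<psi>K by (simp add: \<phi>_def)

  have form_a: "form t (?a j x) y = form t x (?a j y)"
    if "j \<in> J" "x \<in> P_part t" "y \<in> P_part t" for j x y
    using sa_centroid_form[OF A.component_sa[OF \<theta>I]] that by blast
  have form_b: "form t (?b j x) y = form t x (?b j y)"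
    if "j \<in> J" "x \<in> P_part t" "y \<in> P_part t" for j x y
    using sa_centroid_form[OF B.component_sa] that by blast
  have aP: "?a j x \<in> P_part t" and bP: "?b j x \<in> P_part t" if "j \<in> J" "x \<in> P_part t" for j x
    using A.component_P_t[OF \<theta>I] B.component_P_t that by auto
  have c_sa: "form t (c x) y = form t x (c y)" if "x \<in> P_part t" "y \<in> P_part t" for x y
    using that by (simp add: c_def A.form_sum_left A.form_sum_right aP bP form_a form_b)
  have n_sa: "n \<in> sa_centroid t"
  proof (rule A.sa_centroidI[OF nc])
    show "form t (n x) y = form t x (n y)" if "x \<in> P_part t" "y \<in> P_part t" for x y
      using that c_sa
      by (simp add: n_def A.form_diff_left A.form_diff_right A.centroid_P[OF cc])
  qed
  have b_\<psi>: "?b j (\<psi> x) = ?b j (?a j x)" if j: "j \<in> J" and x: "x \<in> carr t" for j x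
    by (rule B.component_unique[where f = "\<lambda>j. ?b j (?a j x)", OF _ _ j])
      (use x in \<open>auto simp: \<psi>_def intro!: B.component_in A.component_carr \<theta>I\<close>)
  have form_\<psi>: "form t (\<psi> x) (\<psi> y) = form t x (c y)"
    if xy: "x \<in> P_part t" "y \<in> P_part t" for x y
  proof -
    have "form t (\<psi> x) (\<psi> y) = (\<Sum>j\<in>J. form t (?b j (?a j x)) (?b j (?a j y)))"
      using xy B.form_eq_sum_components[of "\<psi> x" "\<psi> y"]
      by (simp add: A.centroid_P[OF \<psi>c] b_\<psi> A.P_carr)
    also have "\<dots> = (\<Sum>j\<in>J. form t x (?a j (?b j (?a j y))))"
    proof (rule sum.cong)
      fix j assume j: "j \<in> J"
      then show "form t (?b j (?a j x)) (?b j (?a j y)) = form t x (?a j (?b j (?a j y)))"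
        using xy by (simp add: aP bP form_a form_b A.P_carr A.component_carr \<theta>I B.component_component)
    qed simp
    also have "\<dots> = form t x (c y)"
      using xy by (simp add: c_def A.form_sum_right aP bP)
    finally show ?thesis .
  qed

  have n_central: "n x \<in> central_part t" if "x \<in> P_part t" for x
    using A.centroid_zero_on_K_imp_central[OF nc nK that] .
  have a_c: "?a j (c x) = ?a j (?b j (?a j x))" if j: "j \<in> J" and x: "x \<in> carr t" for j x
  proof -
    have "?a j (c x) = (\<Sum>l\<in>J. ?a j (?a l (?b l (?a l x))))"
      unfolding c_def
      by (rule A.centroid_sum_arg[OF ac[OF j]])
        (use x in \<open>auto intro!: A.component_carr B.component_carr \<theta>I\<close>)
    also have "\<dots> = (\<Sum>l\<in>J. if l = j then ?a j (?b j (?a j x)) else 0)"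
      using j x by (intro sum.cong) (auto simp: aa A.component_carr B.component_carr \<theta>I)
    also have "\<dots> = ?a j (?b j (?a j x))" using j B.finite_index by simp
    finally show ?thesis .
  qed
  \<comment> \<open>On central vectors \<open>\<pi>'\<^sub>j\<^sub>0\<close> preserves the form, whatever the non-flat summands are; so on
    the flat summand, which consists of central vectors, there is no defect to correct.\<close>
  have flat_fixed: "?a j\<^sub>0 (?b j\<^sub>0 (?a j\<^sub>0 x)) = ?a j\<^sub>0 x" if x: "x \<in> P_part t" for x
  proof -
    let ?u = "?a j\<^sub>0 x"
    have central: "?a j\<^sub>0 v \<in> central_part t" if "v \<in> P_part t" for v
      using A.flat_summand_central[OF \<theta>I[OF j0(1)] j0(2) that] .
    have "?a j\<^sub>0 (?b j\<^sub>0 ?u) - ?u = 0"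
    proof (rule A.form_nondegenerate)
      show "?a j\<^sub>0 (?b j\<^sub>0 ?u) - ?u \<in> P_part t"
        using x j0(1) by (simp add: aP bP A.P_intros)
      fix v assume v: "v \<in> P_part t"
      have "form t (?a j\<^sub>0 (?b j\<^sub>0 ?u)) v = form t (?b j\<^sub>0 ?u) (?b j\<^sub>0 (?a j\<^sub>0 v))"
        using x v j0(1) by (simp add: aP bP form_a B.form_component)
      also have "\<dots> = form t ?u (?a j\<^sub>0 v)"
        using B.form_on_central_part[OF j0(1) ind' central[OF x] central[OF v]] by blast
      also have "\<dots> = form t ?u v"
        using x v j0(1) A.form_component(1)[OF \<theta>I[OF j0(1)] x v] by simp
      finally show "form t (?a j\<^sub>0 (?b j\<^sub>0 ?u) - ?u) v = 0"
        using x v j0(1) by (simp add: aP bP A.form_diff_left)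
    qed
    then show ?thesis by simp
  qed
  have n_isotropic: "form t (n x) (n y) = 0" if xy: "x \<in> P_part t" "y \<in> P_part t" for x y
  proof -
    have "?a j\<^sub>0 (n x) = 0"
      using A.P_carr[OF xy(1)] a_c[OF j0(1)] flat_fixed[OF xy(1)] j0(1)
      by (simp add: n_def A.centroid_diff[OF ac] A.centroid_closed[OF cc])
    then show ?thesis
      using A.form_on_central_part[OF \<theta>I[OF j0(1)] ind n_central[OF xy(1)] n_central[OF xy(2)]]
        xy aP[OF j0(1)] A.centroid_P[OF nc] by (simp add: A.form_zero_left)
  qed
  have nn: "n (n x) = 0" if "x \<in> P_part t" for x
    using A.square_zero_of_isotropic_range[OF n_isotropic n_sa that] .
  have \<phi>_iso: "form t (\<phi> x) (\<phi> y) = form t x y" if xy: "x \<in> P_part t" "y \<in> P_part t" for x y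
  proof -
    note nP = A.centroid_P[OF nc]
    have c_n: "c z = z + n z" for z by (simp add: n_def)
    have "c (y - (1/2) *\<^sub>R n y) = y + (1/2) *\<^sub>R n y"
      using A.P_carr[OF xy(2)] nn[OF xy(2)] scaleR_add_left[of "1/2" "1/2" "n y"]
      by (simp add: c_n A.centroid_simps[OF nc] A.carr_intros algebra_simps)
    then have "form t (\<phi> x) (\<phi> y) = form t (x - (1/2) *\<^sub>R n x) (y + (1/2) *\<^sub>R n y)"
      unfolding \<phi>_def using xy nP by (simp add: form_\<psi> A.P_intros)
    also have "\<dots> = form t x y"
      using xy nP n_isotropic sa_centroid_form[OF n_sa xy]
      by (simp add: A.form_diff_left A.form_add_right A.form_scale_left A.form_scale_right A.P_intros)
    finally show ?thesis .
  qed
  have aut: "triple_automorphism \<phi> t"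
    using A.isometry_in_centroid_automorphism[OF \<phi>c \<phi>K \<phi>_iso] .

  have a_n: "?a j (n x) = n (?a j x)" if j: "j \<in> J" and x: "x \<in> carr t" for j x
  proof -
    have "c (?a j x) = (\<Sum>l\<in>J. if l = j then ?a j (?b j (?a j x)) else 0)"
      unfolding c_def using j x
      by (intro sum.cong) (auto simp: aa A.centroid_zero[OF ac] A.centroid_zero[OF bc])
    then have "c (?a j x) = ?a j (c x)"
      using j B.finite_index by (simp add: a_c[OF j x])
    then show ?thesis
      using x by (simp add: n_def A.centroid_diff[OF ac[OF j]] A.centroid_closed[OF cc])
  qed
  have b_\<phi>: "?b j (\<phi> x) = \<phi> (?a j x)" if j: "j \<in> J" and x: "x \<in> carr t" for j x
  proof -
    have b_\<psi>': "\<psi> (?a j y) = ?b j (\<psi> y)" if y: "y \<in> carr t" for y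
    proof -
      have "\<psi> (?a j y) = (\<Sum>l\<in>J. if l = j then ?b j (?a j y) else 0)"
        unfolding \<psi>_def using j y by (intro sum.cong) (auto simp: aa A.centroid_zero[OF bc])
      then show ?thesis using j B.finite_index by (simp add: b_\<psi>[OF j y])
    qed
    have "?a j (x - (1/2) *\<^sub>R n x) = ?a j x - (1/2) *\<^sub>R n (?a j x)"
      using x a_n[OF j x]
      by (simp add: A.centroid_simps[OF ac[OF j]] A.centroid_closed[OF nc] A.carr_intros)
    moreover have "x - (1/2) *\<^sub>R n x \<in> carr t"
      using x A.centroid_closed[OF nc x] by (simp add: A.carr_intros)
    ultimately show ?thesis
      using b_\<psi>'[of "x - (1/2) *\<^sub>R n x"] unfolding \<phi>_def by presburger
  qed
  have "triple_iso \<phi> (s (\<theta> j)) (s' j)" if j: "j \<in> J" for j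
  proof -
    note i = \<theta>I[OF j]
    have bij: "bij_betw \<phi> (carr t) (carr t)"
      using aut by (simp add: triple_automorphism_def triple_iso_def)
    have a_id: "?a j x = x" if "x \<in> carr (s (\<theta> j))" for x
      using A.component_of_summand[OF i i that] by simp
    have maps: "\<phi> x \<in> carr (s' j)" if x: "x \<in> carr (s (\<theta> j))" for x
      using b_\<phi>[OF j A.summand_carr[OF i x]] a_id[OF x]
        B.component_in[OF j A.centroid_closed[OF \<phi>c A.summand_carr[OF i x]]] by simp
    have onto: "y \<in> \<phi> ` carr (s (\<theta> j))" if y: "y \<in> carr (s' j)" for y
    proof -
      obtain x where x: "x \<in> carr t" "y = \<phi> x"
        using bij B.summand_carr[OF j y] by (auto simp: bij_betw_def)
      have "y = ?b j y" using B.component_of_summand[OF j j y] by simp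
      also have "\<dots> = \<phi> (?a j x)" using x b_\<phi>[OF j] by simp
      finally show ?thesis using A.component_in[OF i x(1)] by blast
    qed
    have "bij_betw \<phi> (carr (s (\<theta> j))) (carr (s' j))"
      unfolding bij_betw_def
    proof
      show "inj_on \<phi> (carr (s (\<theta> j)))"
        using bij A.summand_carr[OF i] by (auto simp: bij_betw_def intro: inj_on_subset)
      show "\<phi> ` carr (s (\<theta> j)) = carr (s' j)" using maps onto by blast
    qed
    moreover have "linear_on (carr (s (\<theta> j))) \<phi>"
      using linear_on_subset[OF A.centroid_linear[OF \<phi>c]] A.summand_carr[OF i] by blast
    moreover have "\<phi> x \<in> P_part (s' j)" if "x \<in> P_part (s (\<theta> j))" for x
      using that maps A.centroid_P[OF \<phi>c] by (simp add: A.summand_P[OF i] B.summand_P[OF j])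
    ultimately show ?thesis
      using aut maps A.summand_carr[OF i] \<phi>_iso
      by (auto simp: triple_iso_def triple_automorphism_def A.summand_br[OF i] B.summand_br[OF j]
          A.summand_invol[OF i] B.summand_invol[OF j] A.summand_form[OF i] B.summand_form[OF j]
          A.summand_P[OF i])
  qed
  then show ?thesis using aut by blast
qed

end

theorem theorem2p2p2:
  fixes t :: "'a::real_vector triple"
    and s s' :: "nat \<Rightarrow> 'a triple"
    and p q :: nat
  assumes "symplectic_symmetric_triple t"
    and "direct_sum_of t {0..p} s"
    and "direct_sum_of t {0..q} s'"
    and "flat (s 0)" and "flat (s' 0)"
    and "\<And>\<alpha>. \<alpha> \<in> {1..p} \<Longrightarrow> indecomposable (s \<alpha>) \<and> \<not> flat (s \<alpha>)"
    and "\<And>\<beta>. \<beta> \<in> {1..q} \<Longrightarrow> indecomposable (s' \<beta>) \<and> \<not> flat (s' \<beta>)"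
  shows "p = q \<and>
    (\<exists>\<eta> \<phi>. \<eta> permutes {1..p} \<and> triple_automorphism \<phi> t \<and>
      triple_iso \<phi> (s 0) (s' 0) \<and>
      (\<forall>\<alpha>\<in>{1..p}. triple_iso \<phi> (s \<alpha>) (s' (\<eta> \<alpha>))))"
proof -
  interpret A: triple_sum t "{0..p}" s
    using assms by (simp add: triple_sum_def triple_sum_axioms_def)
  interpret B: triple_sum t "{0..q}" s'
    using assms by (simp add: triple_sum_def triple_sum_axioms_def)
  interpret AB: two_triple_sums t "{0..p}" s "{0..q}" s' ..
  interpret BA: two_triple_sums t "{0..q}" s' "{0..p}" s ..
  have "\<exists>\<beta>\<in>{1..q}. K_part (s \<alpha>) \<subseteq> K_part (s' \<beta>)" if \<alpha>: "\<alpha> \<in> {1..p}" for \<alpha>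
  proof -
    obtain \<beta> where \<beta>: "\<beta> \<in> {0..q}" "\<not> flat (s' \<beta>)" "K_part (s \<alpha>) \<subseteq> K_part (s' \<beta>)"
      using AB.K_part_in_one_summand[of \<alpha>] assms(6)[OF \<alpha>] \<alpha> by auto
    then have "\<beta> \<noteq> 0" using assms(5) by metis
    then show ?thesis using \<beta> by auto
  qed
  then obtain \<eta> where \<eta>: "\<And>\<alpha>. \<alpha> \<in> {1..p} \<Longrightarrow> \<eta> \<alpha> \<in> {1..q} \<and> K_part (s \<alpha>) \<subseteq> K_part (s' (\<eta> \<alpha>))"
    by metis
  have "\<exists>\<alpha>\<in>{1..p}. K_part (s' \<beta>) \<subseteq> K_part (s \<alpha>)" if \<beta>: "\<beta> \<in> {1..q}" for \<beta>
  proof -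
    obtain \<alpha> where \<alpha>: "\<alpha> \<in> {0..p}" "\<not> flat (s \<alpha>)" "K_part (s' \<beta>) \<subseteq> K_part (s \<alpha>)"
      using BA.K_part_in_one_summand[of \<beta>] assms(7)[OF \<beta>] \<beta> by auto
    then have "\<alpha> \<noteq> 0" using assms(4) by metis
    then show ?thesis using \<alpha> by auto
  qed
  then obtain \<theta> where \<theta>: "\<And>\<beta>. \<beta> \<in> {1..q} \<Longrightarrow> \<theta> \<beta> \<in> {1..p} \<and> K_part (s' \<beta>) \<subseteq> K_part (s (\<theta> \<beta>))"
    by metis
  have A_eq: "\<alpha> = \<alpha>'"
    if "\<alpha> \<in> {1..p}" "\<alpha>' \<in> {1..p}" "K_part (s \<alpha>) \<subseteq> K_part (s \<alpha>')" for \<alpha> \<alpha>'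
    using A.K_part_included_imp_flat[of \<alpha> \<alpha>'] assms(6)[OF that(1)] that by auto
  have B_eq: "\<beta> = \<beta>'"
    if "\<beta> \<in> {1..q}" "\<beta>' \<in> {1..q}" "K_part (s' \<beta>) \<subseteq> K_part (s' \<beta>')" for \<beta> \<beta>'
    using B.K_part_included_imp_flat[of \<beta> \<beta>'] assms(7)[OF that(1)] that by auto
  have \<theta>\<eta>: "\<theta> (\<eta> \<alpha>) = \<alpha>" if "\<alpha> \<in> {1..p}" for \<alpha>
    using A_eq[OF that, of "\<theta> (\<eta> \<alpha>)"] \<eta>[OF that] \<theta>[of "\<eta> \<alpha>"] by (metis subset_trans)
  have \<eta>\<theta>: "\<eta> (\<theta> \<beta>) = \<beta>" if "\<beta> \<in> {1..q}" for \<beta>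
    using B_eq[OF that, of "\<eta> (\<theta> \<beta>)"] \<theta>[OF that] \<eta>[of "\<theta> \<beta>"] by (metis subset_trans)
  have bij: "bij_betw \<eta> {1..p} {1..q}"
    by (rule bij_betw_byWitness[of _ \<theta>]) (use \<eta> \<theta> \<theta>\<eta> \<eta>\<theta> in auto)
  then have pq: "p = q" using bij_betw_same_card by fastforce

  \<comment> \<open>The flat summands are matched at index \<open>0\<close>, while a permutation of \<open>{1..p}\<close> is the identity
    on all other natural numbers.\<close>
  define \<theta>' where "\<theta>' = (\<lambda>\<beta>. if \<beta> = 0 then 0 else \<theta> \<beta>)"
  define \<eta>' where "\<eta>' = (\<lambda>\<alpha>. if \<alpha> \<in> {1..p} then \<eta> \<alpha> else \<alpha>)"
  have "\<exists>\<phi>. triple_automorphism \<phi> t \<and> (\<forall>\<beta>\<in>{0..q}. triple_iso \<phi> (s (\<theta>' \<beta>)) (s' \<beta>))"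
  proof (rule AB.isomorphic_decompositions)
    show "bij_betw \<theta>' {0..q} {0..p}"
    proof (rule bij_betw_byWitness[of _ \<eta>'])
      show "\<forall>\<beta>\<in>{0..q}. \<eta>' (\<theta>' \<beta>) = \<beta>"
        using \<theta> \<eta>\<theta> by (auto simp: \<eta>'_def \<theta>'_def)
      show "\<forall>\<alpha>\<in>{0..p}. \<theta>' (\<eta>' \<alpha>) = \<alpha>"
        using \<eta> \<theta>\<eta> by (fastforce simp: \<eta>'_def \<theta>'_def)
      show "\<theta>' ` {0..q} \<subseteq> {0..p}" "\<eta>' ` {0..p} \<subseteq> {0..q}"
        using \<theta> \<eta> by (fastforce simp: \<eta>'_def \<theta>'_def)+
    qed
    show "K_part (s (\<theta>' \<beta>)) = K_part (s' \<beta>)" if "\<beta> \<in> {0..q}" for \<beta>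
    proof (cases "\<beta> = 0")
      case True
      then show ?thesis using assms(4,5) by (simp add: flat_def \<theta>'_def)
    next
      case False
      then have \<beta>: "\<beta> \<in> {1..q}" using that by auto
      then have "K_part (s (\<theta> \<beta>)) \<subseteq> K_part (s' \<beta>)"
        using \<eta>[of "\<theta> \<beta>"] \<theta>[OF \<beta>] \<eta>\<theta>[OF \<beta>] by metis
      then have "K_part (s (\<theta> \<beta>)) = K_part (s' \<beta>)" using \<theta>[OF \<beta>] by blast
      then show ?thesis using False by (simp add: \<theta>'_def)
    qed
  qed (use assms in \<open>auto simp: \<theta>'_def\<close>)
  then obtain \<phi> where \<phi>: "triple_automorphism \<phi> t"
    "\<And>\<beta>. \<beta> \<in> {0..q} \<Longrightarrow> triple_iso \<phi> (s (\<theta>' \<beta>)) (s' \<beta>)" by blast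
  have "bij_betw \<eta>' {1..p} {1..p}"
    using bij pq bij_betw_cong[of "{1..p}" \<eta>' \<eta> "{1..p}"] by (simp add: \<eta>'_def)
  then have "\<eta>' permutes {1..p}"
    by (rule bij_imp_permutes) (auto simp: \<eta>'_def)
  moreover have "triple_iso \<phi> (s 0) (s' 0)" using \<phi>(2)[of 0] by (simp add: \<theta>'_def)
  moreover have "triple_iso \<phi> (s \<alpha>) (s' (\<eta>' \<alpha>))" if \<alpha>: "\<alpha> \<in> {1..p}" for \<alpha>
    using \<phi>(2)[of "\<eta> \<alpha>"] \<eta>[OF \<alpha>] \<theta>\<eta>[OF \<alpha>] \<alpha> by (auto simp: \<eta>'_def \<theta>'_def)
  ultimately show ?thesis using pq \<phi>(1) by blast
qed

end
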